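(* Let $P$ be a $4$-polytope with a simplex facet $S$ in bounded position, with the vertices of $S$ labelled $v_0,v_1,v_2,v_3$ in any order. Then $f(\mathcal I^1(P;S))=f(P)+(5,20,20,5)$ and $f(\mathcal I^2(P;S))=f(P)+(4,16,16,4)$, where $f=(f_0,f_1,f_2,f_3)$ is the $f$-vector ($f_i$ = number of $i$-faces).
   Context: Conventions: for a $4$-polytope $Q\subset\mathbb R^4$ and a facet $F$, $H_F$ is the affine hull of $F$, oriented so that $Q$ lies on its closed positive side; $H_F^+$, $H_F^-$ are the open positive and negative sides. Facets are adjacent if they share a ridge ($2$-face). For a facet $T$ of $Q$ and disjoint sets $\mathcal F,\mathcal N$ of facets adjacent to $T$, $V_T(\mathcal F,\mathcal N;Q)$ is the set of points lying in $H_F^-$ for $F\in\mathcal N\cup\{T\}$, in $H_F$ for $F\in\mathcal F$, and in $H_F^+$ for all other facets $F$ of $Q$. A simplex facet is a facet that is a $3$-simplex; a simplex facet $S$ is in bounded position if the affine hulls of the four facets adjacent to $S$ meet in a point of $H_S^-$. A facet adjacent to a simplex facet $T$ is specified below by the vertex set of the triangle it shares with $T$. Construction $\mathcal I^1$: let $P^{(0)}=P$ and for $i=1,\dots,5$ let $P^{(i)}=\operatorname{conv}(P^{(i-1)}\cup\{v_{3+i}\})$ with $v_{3+i}\in V_{S_i}(\mathcal F_i,\emptyset;P^{(i-1)})$, where: $i=1$: $S_1=S$, $\mathcal F_1$ = facet across $\{v_0,v_1,v_2\}$; $i=2$: $S_2=\operatorname{conv}\{v_0,v_1,v_3,v_4\}$,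 $\mathcal F_2$ = facets across $\{v_1,v_3,v_4\}$ and $\{v_0,v_1,v_3\}$; $i=3$: $S_3=\operatorname{conv}\{v_0,v_2,v_3,v_4\}$, $\mathcal F_3$ = facets across $\{v_0,v_3,v_4\}$ and $\{v_0,v_2,v_3\}$; $i=4$: $S_4=\operatorname{conv}\{v_2,v_3,v_4,v_6\}$, $\mathcal F_4$ = facets across $\{v_2,v_3,v_4\}$ and $\{v_2,v_3,v_6\}$; $i=5$: $S_5=\operatorname{conv}\{v_0,v_2,v_4,v_6\}$, $\mathcal F_5$ = facets across $\{v_0,v_4,v_6\}$, $\{v_2,v_4,v_6\}$, $\{v_0,v_2,v_4\}$. Set $\mathcal I^1(P;S)=P^{(5)}$. Construction $\mathcal I^2$: let $Q^{(0)}=P$ and for $i=1,\dots,4$ let $Q^{(i)}=\operatorname{conv}(Q^{(i-1)}\cup\{v_{3+i}\})$ with $v_{3+i}\in V_{S_i}(\mathcal F_i,\mathcal N_i;Q^{(i-1)})$, where: $i=1$: $S_1=S$, $\mathcal F_1$ = facet across $\{v_0,v_1,v_3\}$, $\mathcal N_1=\emptyset$; $i=2$: $S_2=\operatorname{conv}\{v_1,v_2,v_3,v_4\}$, $\mathcal F_2$ = facets across $\{v_1,v_2,v_4\}$ and $\{v_1,v_2,v_3\}$, $\mathcal N_2=\emptyset$; $i=3$: $S_3=\operatorname{conv}\{v_0,v_2,v_3,v_4\}$, $\mathcal F_3$ = facets across $\{v_0,v_2,v_4\}$ and $\{v_0,v_2,v_3\}$, $\mathcal N_3$ = facet across $\{v_2,v_3,v_4\}$;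 $i=4$: $S_4=\operatorname{conv}\{v_3,v_4,v_5,v_6\}$, $\mathcal F_4$ = facets across $\{v_3,v_4,v_6\}$, $\{v_3,v_4,v_5\}$, $\{v_3,v_5,v_6\}$, $\mathcal N_4=\emptyset$. Set $\mathcal I^2(P;S)=Q^{(4)}$. (In both constructions each $S_i$ is a simplex facet of the previous polytope, the regions are nonempty, and the combinatorial type of the result depends only on $P$, $S$ and the labelling.) *)

theory Defs
  imports "HOL-Analysis.Analysis"
begin

type_synonym pt = "real^4"

definition pos_side :: "pt set \<Rightarrow> pt set \<Rightarrow> pt set" where
  "pos_side Q F = {x. \<exists>a b. a \<noteq> 0 \<and> affine hull F = {y. a \<bullet> y = b}
                       \<and> Q \<subseteq> {y. a \<bullet> y \<le> b} \<and> a \<bullet> x < b}"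

definition neg_side :: "pt set \<Rightarrow> pt set \<Rightarrow> pt set" where
  "neg_side Q F = {x. \<exists>a b. a \<noteq> 0 \<and> affine hull F = {y. a \<bullet> y = b}
                       \<and> Q \<subseteq> {y. a \<bullet> y \<le> b} \<and> a \<bullet> x > b}"

definition adjacent_facet :: "pt set \<Rightarrow> pt set \<Rightarrow> pt set \<Rightarrow> bool" where
  "adjacent_facet Q T F \<longleftrightarrow> T facet_of Q \<and> F facet_of Q \<and> F \<noteq> T \<and> aff_dim (F \<inter> T) = 2"

definition facet_across :: "pt set \<Rightarrow> pt set \<Rightarrow> pt set \<Rightarrow> pt set" where
  "facet_across Q T X = (THE F. F facet_of Q \<and> F \<noteq> T \<and> F \<inter> T = convex hull X)"

definition region :: "pt set \<Rightarrow> pt set \<Rightarrow> pt set set \<Rightarrow> pt set set \<Rightarrow> pt set" where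
  "region Q T FF NN = {x. x \<in> neg_side Q T
      \<and> (\<forall>F\<in>NN. x \<in> neg_side Q F)
      \<and> (\<forall>F\<in>FF. x \<in> affine hull F)
      \<and> (\<forall>F. F facet_of Q \<and> F \<noteq> T \<and> F \<notin> FF \<and> F \<notin> NN \<longrightarrow> x \<in> pos_side Q F)}"

definition bounded_position :: "pt set \<Rightarrow> pt set \<Rightarrow> bool" where
  "bounded_position Q S \<longleftrightarrow> S facet_of Q \<and>
     (\<exists>p. \<Inter>{affine hull F | F. adjacent_facet Q S F} = {p} \<and> p \<in> neg_side Q S)"

definition add_pt :: "pt set \<Rightarrow> pt \<Rightarrow> pt set" where
  "add_pt Q v = convex hull (Q \<union> {v})"

definition fvec :: "pt set \<Rightarrow> nat list" where
  "fvec Q = map (\<lambda>i. card {F. F face_of Q \<and> aff_dim F = int i}) [0,1,2,3]"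

definition I1_choice :: "pt set \<Rightarrow> pt \<Rightarrow> pt \<Rightarrow> pt \<Rightarrow> pt \<Rightarrow> pt \<Rightarrow> pt \<Rightarrow> pt \<Rightarrow> pt \<Rightarrow> pt \<Rightarrow> bool" where
  "I1_choice P v0 v1 v2 v3 v4 v5 v6 v7 v8 \<longleftrightarrow>
    (let P1 = add_pt P v4; P2 = add_pt P1 v5; P3 = add_pt P2 v6; P4 = add_pt P3 v7;
         S1 = convex hull {v0,v1,v2,v3}; S2 = convex hull {v0,v1,v3,v4};
         S3 = convex hull {v0,v2,v3,v4}; S4 = convex hull {v2,v3,v4,v6};
         S5 = convex hull {v0,v2,v4,v6} in
     v4 \<in> region P S1 {facet_across P S1 {v0,v1,v2}} {} \<and>
     v5 \<in> region P1 S2 {facet_across P1 S2 {v1,v3,v4}, facet_across P1 S2 {v0,v1,v3}} {} \<and>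
     v6 \<in> region P2 S3 {facet_across P2 S3 {v0,v3,v4}, facet_across P2 S3 {v0,v2,v3}} {} \<and>
     v7 \<in> region P3 S4 {facet_across P3 S4 {v2,v3,v4}, facet_across P3 S4 {v2,v3,v6}} {} \<and>
     v8 \<in> region P4 S5 {facet_across P4 S5 {v0,v4,v6}, facet_across P4 S5 {v2,v4,v6},
                          facet_across P4 S5 {v0,v2,v4}} {})"

definition I1_result :: "pt set \<Rightarrow> pt \<Rightarrow> pt \<Rightarrow> pt \<Rightarrow> pt \<Rightarrow> pt \<Rightarrow> pt set" where
  "I1_result P v4 v5 v6 v7 v8 = add_pt (add_pt (add_pt (add_pt (add_pt P v4) v5) v6) v7) v8"

definition I2_choice :: "pt set \<Rightarrow> pt \<Rightarrow> pt \<Rightarrow> pt \<Rightarrow> pt \<Rightarrow> pt \<Rightarrow> pt \<Rightarrow> pt \<Rightarrow> pt \<Rightarrow> bool" where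
  "I2_choice P v0 v1 v2 v3 v4 v5 v6 v7 \<longleftrightarrow>
    (let Q1 = add_pt P v4; Q2 = add_pt Q1 v5; Q3 = add_pt Q2 v6;
         S1 = convex hull {v0,v1,v2,v3}; S2 = convex hull {v1,v2,v3,v4};
         S3 = convex hull {v0,v2,v3,v4}; S4 = convex hull {v3,v4,v5,v6} in
     v4 \<in> region P S1 {facet_across P S1 {v0,v1,v3}} {} \<and>
     v5 \<in> region Q1 S2 {facet_across Q1 S2 {v1,v2,v4}, facet_across Q1 S2 {v1,v2,v3}} {} \<and>
     v6 \<in> region Q2 S3 {facet_across Q2 S3 {v0,v2,v4}, facet_across Q2 S3 {v0,v2,v3}}
                        {facet_across Q2 S3 {v2,v3,v4}} \<and>
     v7 \<in> region Q3 S4 {facet_across Q3 S4 {v3,v4,v6}, facet_across Q3 S4 {v3,v4,v5},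
                         facet_across Q3 S4 {v3,v5,v6}} {})"

definition I2_result :: "pt set \<Rightarrow> pt \<Rightarrow> pt \<Rightarrow> pt \<Rightarrow> pt \<Rightarrow> pt set" where
  "I2_result P v4 v5 v6 v7 = add_pt (add_pt (add_pt (add_pt P v4) v5) v6) v7"

end

theory Submission
  imports Defs
begin

text \<open>Let \<open>Q'\<close> be the hull of \<open>Q\<close> and a point \<open>v\<close>. A proper face \<open>G\<close> of \<open>Q\<close> remains a face iff it lies in a
  facet which \<open>v\<close> is beneath, and the hull of \<open>G\<close> and \<open>v\<close> is a face iff \<open>G\<close> lies both in a facet which \<open>v\<close>
  is beneath and in one which \<open>v\<close> is beyond, or \<open>v\<close> lies on all facet hyperplanes through \<open>G\<close>. In the last case \<open>v\<close> is in the
  affine hull of \<open>G\<close>, so the dimension is unchanged. Therefore only the faces of the facets which \<open>v\<close> is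
  beyond change the \<open>f\<close>-vector: \<open>f\<^sub>i\<close> drops by the number of their \<open>i\<close>-faces in no facet which \<open>v\<close> is beneath and grows by the
  number of their \<open>(i - 1)\<close>-faces in some such facet.

  In both constructions the facets which the new point is beyond are simplices on labelled points. Placing a
  point on the hyperplanes of \<open>k\<close> neighbours of one such simplex adds \<open>(1, 4, 6 - k, 3 - k)\<close> if every
  edge of the simplex lies in a facet which the point is beneath. This applies to all steps but the third one of
  the second construction, which adds \<open>(1, 4, 4, 1)\<close>.\<close>

section \<open>Facets, ridges and small perturbations\<close>

text \<open>\<open>P\<close> is arbitrary, so its faces cannot be listed. The way out is that each
  lost or coned face is a set of labels, and whether it survives depends only on the label sets of
  the facets. The family of these label sets obeys a transition rule of its own: a label set stays
  if the new point is beneath its facets, gains the new label if the point is on their hyperplanes,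
  and disappears if it is beyond; each triangle common to a facet beyond and a facet beneath yields
  a new tetrahedron. Iterating this rule is a finite computation with sets of numbers, and the
  unknown rest \<open>R\<close> of the family passes through it unchanged.

  The increment for one simplex and \<open>k\<close> neighbours arises as follows. The empty face is
  coned to the new vertex, the 4 vertices to edges, and the 6 edges to triangles, while
  \<open>k\<close> triangles disappear. The other 4 - \<open>k\<close> triangles are coned to
  facets, while the simplex itself disappears.\<close>

lemma facet_subset_facet_eq:
  fixes Q :: "'a::euclidean_space set"
  assumes "convex Q" "F facet_of Q" "G facet_of Q" "F \<subseteq> G"
  shows "F = G"
proof (rule ccontr)
  assume "F \<noteq> G"
  moreover have "F face_of G"
    using assms by (meson face_of_subset facet_of_imp_face_of facet_of_imp_subset)
  ultimately have "aff_dim F < aff_dim G"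
    by (meson assms(3) face_of_aff_dim_lt face_of_imp_convex facet_of_imp_face_of)
  then show False
    using assms by (simp add: facet_of_def)
qed

lemma face_of_polyhedron_exposing:
  fixes Q :: "'a::euclidean_space set"
  assumes "polyhedron Q" "G face_of Q"
  obtains c d where "\<And>x. x \<in> Q \<Longrightarrow> c \<bullet> x \<le> d" "G = Q \<inter> {x. c \<bullet> x = d}"
proof -
  have "G exposed_face_of Q"
    using assms exposed_face_of_polyhedron by blast
  then show ?thesis
    using that unfolding exposed_face_of_def by blast
qed

text \<open>One functional per facet is fixed, with \<open>Q\<close> on its lower side. Lying
  beneath, on or beyond a facet is then the sign of the slack
  \<open>b F - a F \<bullet> x\<close>.\<close>

locale facet_description =
  fixes Q :: "'a::euclidean_space set" and a :: "'a set \<Rightarrow> 'a" and b :: "'a set \<Rightarrow> real"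
  assumes polytope: "polytope Q" and full_dim: "aff_dim Q = DIM('a)"
    and facet_le: "\<And>F x. F facet_of Q \<Longrightarrow> x \<in> Q \<Longrightarrow> a F \<bullet> x \<le> b F"
    and facet_eq: "\<And>F. F facet_of Q \<Longrightarrow> F = Q \<inter> {x. a F \<bullet> x = b F}"
begin

lemma polyhedron: "polyhedron Q"
  using polytope polytope_imp_polyhedron by blast

lemma convex: "convex Q"
  using polytope polytope_imp_convex by blast

lemma interior_nonempty: "interior Q \<noteq> {}"
proof -
  have "rel_interior Q \<noteq> {}"
    using full_dim convex rel_interior_eq_empty by fastforce
  then show ?thesis
    using full_dim interior_rel_interior_gen by metis
qed

lemma mem_facet_iff: "F facet_of Q \<Longrightarrow> x \<in> Q \<Longrightarrow> x \<in> F \<longleftrightarrow> a F \<bullet> x = b F"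
  using facet_eq by blast

lemma facet_less: "F facet_of Q \<Longrightarrow> x \<in> Q \<Longrightarrow> x \<notin> F \<Longrightarrow> a F \<bullet> x < b F"
  using facet_le mem_facet_iff by fastforce

lemma affine_hull_facet_subset: "F facet_of Q \<Longrightarrow> affine hull F \<subseteq> {x. a F \<bullet> x = b F}"
  using facet_eq by (intro hull_minimal) (auto simp: affine_hyperplane)

text \<open>The segment from an interior point to a point outside \<open>Q\<close> leaves
  \<open>Q\<close> in some facet. The functional of this facet is strictly below its bound at the
  start and reaches the bound there, so it exceeds the bound at the end.\<close>

lemma mem_iff: "x \<in> Q \<longleftrightarrow> (\<forall>F. F facet_of Q \<longrightarrow> a F \<bullet> x \<le> b F)"
proof
  assume R: "\<forall>F. F facet_of Q \<longrightarrow> a F \<bullet> x \<le> b F"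
  show "x \<in> Q"
  proof (rule ccontr)
    assume "x \<notin> Q"
    obtain p where p: "p \<in> interior Q"
      using interior_nonempty by blast
    then have pQ: "p \<in> Q"
      using interior_subset by blast
    define l where "l = x - p"
    have "l \<noteq> 0" "bounded Q"
      using \<open>x \<notin> Q\<close> pQ polytope polytope_imp_bounded by (auto simp: l_def)
    then obtain d where d: "0 < d" "p + d *\<^sub>R l \<in> frontier Q"
        and in_int: "\<And>e. \<lbrakk>0 \<le> e; e < d\<rbrakk> \<Longrightarrow> p + e *\<^sub>R l \<in> interior Q"
      using ray_to_frontier p by blast
    have "d \<le> 1"
      using in_int[of 1] \<open>x \<notin> Q\<close> interior_subset unfolding l_def by force
    have "rel_frontier Q = frontier Q"
      using interior_nonempty rel_frontier_nonempty_interior by blast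
    then obtain F where F: "F facet_of Q" "p + d *\<^sub>R l \<in> F"
      using d rel_frontier_of_polyhedron[OF polyhedron] by auto
    then have "p + d *\<^sub>R l \<in> Q"
      using facet_of_imp_subset by blast
    then have e: "a F \<bullet> (p + d *\<^sub>R l) = b F"
      using F mem_facet_iff by blast
    have "F \<noteq> Q"
      using F(1) by auto
    then have "p \<notin> F"
      using p F(1) face_of_disjoint_interior[OF facet_of_imp_face_of] by blast
    then have s: "a F \<bullet> p < b F"
      using facet_less F pQ by blast
    from e have e1: "a F \<bullet> p + d * (a F \<bullet> l) = b F"
      by (simp add: inner_add_right)
    then have "d * (a F \<bullet> l) > 0"
      using s by linarith
    then have al: "a F \<bullet> l > 0"
      using d(1) by (simp add: zero_less_mult_iff)
    have x: "a F \<bullet> x = a F \<bullet> p + a F \<bullet> l"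
      by (simp add: l_def inner_diff_right)
    have "d = 1 \<or> d < 1"
      using \<open>d \<le> 1\<close> by linarith
    then show False
    proof
      assume "d = 1"
      then show False
        using \<open>p + d *\<^sub>R l \<in> Q\<close> \<open>x \<notin> Q\<close> by (simp add: l_def)
    next
      assume "d < 1"
      then have "d * (a F \<bullet> l) < a F \<bullet> l"
        using al by simp
      then show False
        using R F(1) e1 x by fastforce
    qed
  qed
qed (use facet_le in blast)

lemma finite_facets: "finite {F. F facet_of Q}"
  using polytope finite_polytope_facets by blast

text \<open>A point in the relative interior of a face may be moved slightly in every direction that does not
  point out of the facets through that face, because it lies strictly beneath all other facets.\<close>

lemma perturb_rel_interior:
  assumes "G face_of Q" "x \<in> rel_interior G"
    and u: "\<And>F. \<lbrakk>F facet_of Q; G \<subseteq> F\<rbrakk> \<Longrightarrow> a F \<bullet> u \<le> 0"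
  obtains e where "e > 0" "x + e *\<^sub>R u \<in> Q"
proof -
  have xG: "x \<in> G" and xQ: "x \<in> Q"
    using assms rel_interior_subset face_of_imp_subset by blast+
  have "\<exists>e>0. \<forall>t. 0 < t \<and> t \<le> e \<longrightarrow> a F \<bullet> (x + t *\<^sub>R u) \<le> b F" if F: "F facet_of Q" for F
  proof (cases "G \<subseteq> F")
    case True
    then have "a F \<bullet> x = b F"
      using F xG xQ mem_facet_iff by blast
    moreover have "t * (a F \<bullet> u) \<le> 0" if "t > 0" for t
      using u[OF F True] that by (simp add: mult_nonneg_nonpos)
    ultimately show ?thesis
      by (intro exI[of _ 1]) (auto simp: inner_add_right)
  next
    case False
    have "x \<notin> F"
    proof
      assume "x \<in> F"
      then have "G \<subseteq> F"
        using subset_of_face_of[of F Q G] F assms face_of_imp_subset facet_of_imp_face_of by blast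
      with False show False ..
    qed
    then have s: "a F \<bullet> x < b F"
      using facet_less F xQ by blast
    \<comment> \<open>The summand 1 covers directions parallel to the hyperplane, where the
      denominator would be 0.\<close>
    define e where "e = (b F - a F \<bullet> x) / (\<bar>a F \<bullet> u\<bar> + 1)"
    have "e > 0"
      using s by (simp add: e_def add_nonneg_pos)
    moreover have "a F \<bullet> (x + t *\<^sub>R u) \<le> b F" if "0 < t" "t \<le> e" for t
    proof -
      have "t * (a F \<bullet> u) \<le> t * (\<bar>a F \<bullet> u\<bar> + 1)"
        using that by (intro mult_left_mono) auto
      also have "\<dots> \<le> e * (\<bar>a F \<bullet> u\<bar> + 1)"
        using that by (intro mult_right_mono) auto
      also have "\<dots> = b F - a F \<bullet> x"
        by (simp add: e_def add_nonneg_eq_0_iff)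
      finally show ?thesis
        by (simp add: inner_add_right)
    qed
    ultimately show ?thesis
      by blast
  qed
  then obtain e where e: "\<And>F. F facet_of Q \<Longrightarrow> e F > 0"
      "\<And>F t. \<lbrakk>F facet_of Q; 0 < t; t \<le> e F\<rbrakk> \<Longrightarrow> a F \<bullet> (x + t *\<^sub>R u) \<le> b F"
    by metis
  define m where "m = Min (insert 1 (e ` {F. F facet_of Q}))"
  have fin: "finite (insert 1 (e ` {F. F facet_of Q}))"
    using finite_facets by simp
  have "m > 0"
    unfolding m_def using fin e(1) by (subst Min_gr_iff) auto
  moreover have "m \<le> e F" if "F facet_of Q" for F
    unfolding m_def using fin that by (intro Min_le) auto
  ultimately show ?thesis
    using that e(2) mem_iff by blast
qed

lemma proper_face_subset_facet:
  assumes "G face_of Q" "G \<noteq> Q"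
  obtains F where "F facet_of Q" "G \<subseteq> F"
proof (cases "G = {}")
  case True
  have "Q \<noteq> {}"
    using interior_nonempty by auto
  then have "\<exists>F. F facet_of Q"
    by (metis polytope_facet_exists polytope full_dim DIM_positive of_nat_0_less_iff)
  then show ?thesis
    using True that by blast
next
  case False
  then show ?thesis
    using assms face_of_polyhedron_subset_facet polyhedron that by blast
qed

text \<open>A proper nonempty face is the intersection of the facets through it; if \<open>T\<close>
  were the only one, \<open>G\<close> would be \<open>T\<close>.\<close>

lemma ridge_in_other_facet:
  assumes "T facet_of Q" "G face_of Q" "G \<noteq> {}" "G \<subseteq> T" "G \<noteq> T"
  obtains F where "F facet_of Q" "F \<noteq> T" "G \<subseteq> F"
proof (rule ccontr)
  assume "\<not> thesis"
  then have "{F. F facet_of Q \<and> G \<subseteq> F} = {T}"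
    using assms that by blast
  moreover have "G \<noteq> Q"
    using assms facet_of_imp_subset by (metis facet_of_irrefl subset_antisym)
  then have "G = \<Inter>{F. F facet_of Q \<and> G \<subseteq> F}"
    using assms face_of_polyhedron[OF polyhedron] by blast
  ultimately show False
    using assms by simp
qed

text \<open>The slacks of the three facets are affine functions that vanish on \<open>G\<close>,
  which has codimension 2, so the slack of \<open>F3\<close> is a combination of the other two. The
  coefficients are nonnegative and not both 0, and a positive one forces \<open>F3\<close> into the
  corresponding facet.\<close>

lemma ridge_at_most_two_facets:
  assumes F: "F1 facet_of Q" "F2 facet_of Q" "F3 facet_of Q" "F1 \<noteq> F2"
    and G: "aff_dim G = int DIM('a) - 2" "G \<subseteq> F1" "G \<subseteq> F2" "G \<subseteq> F3"
  shows "F3 = F1 \<or> F3 = F2"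
proof -
  define s where "s = (\<lambda>F x. b F - a F \<bullet> x)"
  have FQ: "F1 \<subseteq> Q" "F2 \<subseteq> Q" "F3 \<subseteq> Q"
    using F facet_of_imp_subset by blast+
  obtain x1 where x1: "x1 \<in> F1" "x1 \<notin> F2"
    using F facet_subset_facet_eq convex by blast
  obtain x2 where x2: "x2 \<in> F2" "x2 \<notin> F1"
    using F facet_subset_facet_eq convex by blast
  have s_ge: "s F x \<ge> 0" and s_zero: "s F x = 0 \<longleftrightarrow> x \<in> F" if "F facet_of Q" "x \<in> Q" for F x
    using facet_le[OF that] mem_facet_iff[OF that] by (auto simp: s_def)
  have s_gt: "s F x > 0" if "F facet_of Q" "x \<in> Q" "x \<notin> F" for F x
    using s_ge[OF that(1,2)] s_zero[OF that(1,2)] that(3) by linarith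
  have xQ: "x1 \<in> Q" "x2 \<in> Q" and GQ: "G \<subseteq> Q"
    using x1 x2 FQ G by auto
  have s1: "s F1 x1 = 0" "s F2 x1 > 0" "s F3 x1 \<ge> 0"
    using x1 F xQ s_ge s_zero s_gt by auto
  have s2: "s F2 x2 = 0" "s F1 x2 > 0" "s F3 x2 \<ge> 0"
    using x2 F xQ s_ge s_zero s_gt by auto
  have sG: "s F1 x = 0" "s F2 x = 0" "s F3 x = 0" if "x \<in> G" for x
    using that G F GQ s_zero by blast+
  have "x1 \<notin> affine hull G"
  proof
    assume "x1 \<in> affine hull G"
    then have "s F2 x1 = 0"
      using affine_hull_facet_subset[OF F(2)] hull_mono[OF G(3), of affine] unfolding s_def by auto
    then show False
      using s1 by simp
  qed
  then have d1: "aff_dim (insert x1 G) = int DIM('a) - 1"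
    using G by (simp add: aff_dim_insert)
  have "x2 \<notin> affine hull (insert x1 G)"
  proof
    assume "x2 \<in> affine hull (insert x1 G)"
    then have "s F1 x2 = 0"
      using affine_hull_facet_subset[OF F(1)] hull_mono[of "insert x1 G" F1 affine] G(2) x1
      unfolding s_def by auto
    then show False
      using s2 by simp
  qed
  then have "aff_dim (insert x2 (insert x1 G)) = int DIM('a)"
    using d1 by (simp add: aff_dim_insert)
  then have U: "affine hull (insert x2 (insert x1 G)) = UNIV"
    using aff_dim_eq_full by blast
  \<comment> \<open>The combination is evaluated at \<open>x2\<close>, where the slack of
    \<open>F2\<close> vanishes, and at \<open>x1\<close>, where that of \<open>F1\<close> vanishes;
    this determines both coefficients.\<close>
  define \<alpha> where "\<alpha> = s F3 x2 / s F1 x2"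
  define \<beta> where "\<beta> = s F3 x1 / s F2 x1"
  have nn: "\<alpha> \<ge> 0" "\<beta> \<ge> 0"
    using s1 s2 by (auto simp: \<alpha>_def \<beta>_def)
  define c where "c = a F3 - \<alpha> *\<^sub>R a F1 - \<beta> *\<^sub>R a F2"
  define d where "d = b F3 - \<alpha> * b F1 - \<beta> * b F2"
  have cd: "d - c \<bullet> x = s F3 x - \<alpha> * s F1 x - \<beta> * s F2 x" for x
    by (simp add: c_def d_def s_def inner_diff_left algebra_simps)
  have "insert x2 (insert x1 G) \<subseteq> {x. c \<bullet> x = d}"
  proof -
    have "d - c \<bullet> x1 = 0" "d - c \<bullet> x2 = 0"
      unfolding cd using s1 s2 by (auto simp: \<alpha>_def \<beta>_def)
    moreover have "d - c \<bullet> x = 0" if "x \<in> G" for x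
      unfolding cd using sG[OF that] by simp
    ultimately show ?thesis
      by force
  qed
  then have "affine hull (insert x2 (insert x1 G)) \<subseteq> {x. c \<bullet> x = d}"
    by (intro hull_minimal) (auto simp: affine_hyperplane)
  then have comb: "s F3 x = \<alpha> * s F1 x + \<beta> * s F2 x" for x
  proof -
    have "c \<bullet> x = d"
      using U \<open>affine hull (insert x2 (insert x1 G)) \<subseteq> {x. c \<bullet> x = d}\<close> by blast
    then show ?thesis
      using cd[of x] by linarith
  qed
  have ge: "s F1 x \<ge> 0" "s F2 x \<ge> 0" if "x \<in> F3" for x
    using that F FQ s_ge by blast+
  have zero: "s F3 x = 0" if "x \<in> F3" for x
    using that F FQ s_zero by blast
  have "F3 = Q" if "\<alpha> = 0" "\<beta> = 0"
  proof -
    have "s F3 x = 0" for x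
      using comb that by simp
    then show ?thesis
      using FQ F(3) s_zero by blast
  qed
  then have "\<alpha> > 0 \<or> \<beta> > 0"
    using nn F(3) by force
  then show ?thesis
  proof
    assume "\<alpha> > 0"
    have "F3 \<subseteq> F1"
    proof
      fix x assume x: "x \<in> F3"
      have "\<alpha> * s F1 x \<le> 0"
        using comb[of x] zero[OF x] ge[OF x] nn mult_nonneg_nonneg[of \<beta> "s F2 x"] by linarith
      then have "s F1 x = 0"
        using \<open>\<alpha> > 0\<close> ge[OF x] by (simp add: mult_le_0_iff)
      then show "x \<in> F1"
        using x F FQ s_zero by blast
    qed
    then show ?thesis
      using F facet_subset_facet_eq convex by blast
  next
    assume "\<beta> > 0"
    have "F3 \<subseteq> F2"
    proof
      fix x assume x: "x \<in> F3"
      have "\<beta> * s F2 x \<le> 0"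
        using comb[of x] zero[OF x] ge[OF x] nn mult_nonneg_nonneg[of \<alpha> "s F1 x"] by linarith
      then have "s F2 x = 0"
        using \<open>\<beta> > 0\<close> ge[OF x] by (simp add: mult_le_0_iff)
      then show "x \<in> F2"
        using x F FQ s_zero by blast
    qed
    then show ?thesis
      using F facet_subset_facet_eq convex by blast
  qed
qed

end

section \<open>Faces of the hull of a polytope and a point\<close>

text \<open>The slack of a convex combination of \<open>v\<close> and a point of \<open>Q\<close> is
  the same combination of two nonnegative slacks. On the hyperplane, every term with positive weight
  therefore has slack 0.\<close>

lemma convex_hull_insert_Int_hyperplane:
  fixes Q :: "'a::euclidean_space set"
  assumes "convex Q" "Q \<noteq> {}" and Q: "\<And>x. x \<in> Q \<Longrightarrow> c \<bullet> x \<le> d" and v: "c \<bullet> v \<le> d"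
  shows "convex hull (insert v Q) \<inter> {x. c \<bullet> x = d} =
    (if c \<bullet> v = d then convex hull (insert v (Q \<inter> {x. c \<bullet> x = d})) else Q \<inter> {x. c \<bullet> x = d})"
    (is "?L = ?R")
proof
  have sub: "?R \<subseteq> convex hull (insert v Q)"
    using hull_mono[of "insert v (Q \<inter> {x. c \<bullet> x = d})" "insert v Q" convex]
      hull_subset[of "insert v Q" convex] by auto
  have "convex hull (insert v (Q \<inter> {x. c \<bullet> x = d})) \<subseteq> {x. c \<bullet> x = d}" if "c \<bullet> v = d"
    using that by (intro hull_minimal) (auto simp: convex_hyperplane)
  then show "?R \<subseteq> ?L"
    using sub by auto
  show "?L \<subseteq> ?R"
  proof
    fix y assume y: "y \<in> ?L"
    then obtain s t q where st: "s \<ge> 0" "t \<ge> 0" "s + t = 1" "q \<in> Q" "y = s *\<^sub>R v + t *\<^sub>R q"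
      using convex_hull_insert[OF assms(2), of v] assms(1) by (auto simp: hull_same)
    have eq: "s * (d - c \<bullet> v) + t * (d - c \<bullet> q) = 0"
    proof -
      have "s * (c \<bullet> v) + t * (c \<bullet> q) = d"
        using y st by (auto simp: inner_add_right)
      moreover have "s * d + t * d = d"
        using st(3) by (metis distrib_right mult_1)
      ultimately show ?thesis
        by (simp add: right_diff_distrib)
    qed
    have "s * (d - c \<bullet> v) \<ge> 0" "t * (d - c \<bullet> q) \<ge> 0"
      using st v Q[of q] by auto
    then have z: "s = 0 \<or> c \<bullet> v = d" "t = 0 \<or> c \<bullet> q = d"
      using eq by (auto simp: add_nonneg_eq_0_iff)
    show "y \<in> ?R"
    proof (cases "c \<bullet> v = d")
      case True
      show ?thesis
      proof (cases "t = 0")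
        case True
        then show ?thesis
          using st \<open>c \<bullet> v = d\<close> by (simp add: hull_inc)
      next
        case False
        then have "q \<in> Q \<inter> {x. c \<bullet> x = d}"
          using z st by auto
        then have "v \<in> convex hull (insert v (Q \<inter> {x. c \<bullet> x = d}))"
          "q \<in> convex hull (insert v (Q \<inter> {x. c \<bullet> x = d}))"
          by (simp_all add: hull_inc)
        then have "y \<in> convex hull (insert v (Q \<inter> {x. c \<bullet> x = d}))"
          using st convexD[OF convex_convex_hull] by blast
        then show ?thesis
          using True by simp
      qed
    next
      case False
      then have "s = 0" "t = 1"
        using z st by auto
      then show ?thesis
        using False st y by auto
    qed
  qed
qed

text \<open>The two existence conditions make the empty face both \<open>on_beneath\<close> and
  \<open>on_beyond\<close>. The new vertex is thus the cone over the empty face, of dimension -1,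
  and needs no treatment of its own. The second condition also puts \<open>v\<close> outside
  \<open>Q\<close>.\<close>

locale beneath_beyond = facet_description Q a b for Q :: "'a::euclidean_space set" and a b +
  fixes v :: 'a
  assumes beneath_ex: "\<exists>F. F facet_of Q \<and> a F \<bullet> v < b F"
    and beyond_ex: "\<exists>F. F facet_of Q \<and> a F \<bullet> v > b F"
begin

definition Q' :: "'a set" where
  "Q' = convex hull (insert v Q)"

definition on_beneath :: "'a set \<Rightarrow> bool" where
  "on_beneath G \<longleftrightarrow> (\<exists>F. F facet_of Q \<and> G \<subseteq> F \<and> a F \<bullet> v < b F)"

definition on_beyond :: "'a set \<Rightarrow> bool" where
  "on_beyond G \<longleftrightarrow> (\<exists>F. F facet_of Q \<and> G \<subseteq> F \<and> a F \<bullet> v > b F)"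

lemma v_notin: "v \<notin> Q"
proof -
  obtain F where "F facet_of Q" "\<not> a F \<bullet> v \<le> b F"
    using beyond_ex by force
  then show ?thesis
    using facet_le by blast
qed

lemma Q_nonempty: "Q \<noteq> {}"
  using interior_nonempty by auto

lemma polytope_Q': "polytope Q'"
proof -
  obtain V where "finite V" "Q = convex hull V"
    using polytope unfolding polytope_def by blast
  then have "Q' = convex hull (insert v V)"
    unfolding Q'_def by (metis hull_insert)
  then show ?thesis
    using \<open>finite V\<close> by (simp add: polytope_convex_hull)
qed

lemma Q_subset_Q': "Q \<subseteq> Q'"
  unfolding Q'_def using hull_subset[of "insert v Q" convex] by blast

lemma v_in_Q': "v \<in> Q'"
  unfolding Q'_def by (simp add: hull_inc)

lemma full_dim_Q': "aff_dim Q' = DIM('a)"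
  using aff_dim_subset[OF Q_subset_Q'] aff_dim_le_DIM[of Q'] full_dim by linarith

lemma supporting_face:
  assumes "\<And>x. x \<in> Q \<Longrightarrow> c \<bullet> x \<le> d" "c \<bullet> v \<le> d"
  shows "Q' \<inter> {x. c \<bullet> x = d} face_of Q'"
proof (rule face_of_Int_supporting_hyperplane_le)
  show "convex Q'"
    by (simp add: Q'_def)
  have "Q' \<subseteq> {x. c \<bullet> x \<le> d}"
    unfolding Q'_def using assms by (intro hull_minimal) (auto simp: convex_halfspace_le)
  then show "\<And>x. x \<in> Q' \<Longrightarrow> c \<bullet> x \<le> d"
    by blast
qed

text \<open>The functional of a facet that \<open>v\<close> is beneath still supports
  \<open>Q'\<close> and cuts out the same facet, so this facet persists together with all its
  faces.\<close>

lemma on_beneath_face: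
  assumes G: "G face_of Q" and "on_beneath G"
  shows "G face_of Q'"
proof -
  obtain F where F: "F facet_of Q" "G \<subseteq> F" "a F \<bullet> v < b F"
    using assms on_beneath_def by blast
  have "F = Q' \<inter> {x. a F \<bullet> x = b F}"
    unfolding Q'_def
    using convex_hull_insert_Int_hyperplane[OF convex Q_nonempty facet_le[OF F(1)], of v] F facet_eq
    by auto
  also have "\<dots> face_of Q'"
    using F facet_le by (intro supporting_face) auto
  finally have "F face_of Q'" .
  moreover have "G face_of F"
    using face_of_subset[OF G F(2)] F(1) facet_of_imp_subset by blast
  ultimately show ?thesis
    using face_of_trans by blast
qed

text \<open>The trace on \<open>Q\<close> gives \<open>G\<close> back from its cone. Injectivity of
  coning rests on this, and so does the fact that a cone picks up no old labels.\<close>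

lemma supporting_cone:
  assumes "\<And>x. x \<in> Q \<Longrightarrow> c \<bullet> x \<le> d" "c \<bullet> v = d" "G = Q \<inter> {x. c \<bullet> x = d}"
  shows "convex hull (insert v G) face_of Q'" "convex hull (insert v G) \<inter> Q = G"
proof -
  have eq: "convex hull (insert v G) = Q' \<inter> {x. c \<bullet> x = d}"
    unfolding Q'_def
    using convex_hull_insert_Int_hyperplane[OF convex Q_nonempty assms(1), of v] assms by auto
  show "convex hull (insert v G) face_of Q'"
    unfolding eq using assms by (intro supporting_face) auto
  show "convex hull (insert v G) \<inter> Q = G"
    unfolding eq using assms Q_subset_Q' by blast
qed

text \<open>The functional exposing \<open>G\<close> is corrected by a nonnegative multiple of the functional of a facet
  through \<open>G\<close> so that it vanishes at \<open>v\<close>.\<close>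

lemma mixed_face:
  assumes G: "G face_of Q" and "on_beneath G" "on_beyond G"
  shows "convex hull (insert v G) face_of Q'" "convex hull (insert v G) \<inter> Q = G"
proof -
  obtain c d where cd: "\<And>x. x \<in> Q \<Longrightarrow> c \<bullet> x \<le> d" "G = Q \<inter> {x. c \<bullet> x = d}"
    using face_of_polyhedron_exposing[OF polyhedron G] by blast
  \<comment> \<open>The facet is chosen so that its slack at \<open>v\<close> cannot have the same
    sign as that of the exposing functional; the multiplier that cancels the two is then
    nonnegative.\<close>
  have "\<exists>F t. F facet_of Q \<and> G \<subseteq> F \<and> t \<ge> 0 \<and> (d - c \<bullet> v) + t * (b F - a F \<bullet> v) = 0"
  proof (cases "d - c \<bullet> v \<ge> 0")
    case True
    obtain F where F: "F facet_of Q" "G \<subseteq> F" "a F \<bullet> v > b F"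
      using assms on_beyond_def by blast
    then show ?thesis
      using True
      by (intro exI[of _ F] exI[of _ "(d - c \<bullet> v) / (a F \<bullet> v - b F)"]) (auto simp: field_simps)
  next
    case False
    obtain F where F: "F facet_of Q" "G \<subseteq> F" "a F \<bullet> v < b F"
      using assms on_beneath_def by blast
    then show ?thesis
      using False
      by (intro exI[of _ F] exI[of _ "(c \<bullet> v - d) / (b F - a F \<bullet> v)"]) (auto simp: field_simps)
  qed
  then obtain F t where F: "F facet_of Q" "G \<subseteq> F" and t: "t \<ge> 0"
      "(d - c \<bullet> v) + t * (b F - a F \<bullet> v) = 0"
    by blast
  define c' where "c' = c + t *\<^sub>R a F"
  define d' where "d' = d + t * b F"
  have slack: "d' - c' \<bullet> x = (d - c \<bullet> x) + t * (b F - a F \<bullet> x)" for x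
    by (simp add: c'_def d'_def inner_add_left algebra_simps)
  have nn: "t * (b F - a F \<bullet> x) \<ge> 0" if "x \<in> Q" for x
    using t facet_le[OF F(1) that] by simp
  have "c' \<bullet> x \<le> d'" if "x \<in> Q" for x
    using slack[of x] nn[OF that] cd(1)[OF that] by linarith
  moreover have "c' \<bullet> v = d'"
    using slack[of v] t by linarith
  moreover have "G = Q \<inter> {x. c' \<bullet> x = d'}"
  proof
    show "G \<subseteq> Q \<inter> {x. c' \<bullet> x = d'}"
    proof
      fix x assume x: "x \<in> G"
      then have "x \<in> Q" "c \<bullet> x = d" "a F \<bullet> x = b F"
        using cd(2) F mem_facet_iff by auto
      then show "x \<in> Q \<inter> {x. c' \<bullet> x = d'}"
        using slack[of x] by simp
    qed
    show "Q \<inter> {x. c' \<bullet> x = d'} \<subseteq> G"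
    proof
      fix x assume x: "x \<in> Q \<inter> {x. c' \<bullet> x = d'}"
      then have "c \<bullet> x = d"
        using slack[of x] nn[of x] cd(1)[of x] by auto
      then show "x \<in> G"
        using x cd(2) by auto
    qed
  qed
  ultimately show "convex hull (insert v G) face_of Q'" "convex hull (insert v G) \<inter> Q = G"
    using supporting_cone by blast+
qed

text \<open>All facet hyperplanes through \<open>G\<close> contain \<open>v\<close>, so the sum of
  their functionals exposes \<open>G\<close> and is tight at \<open>v\<close>. A point in the
  relative interior of \<open>G\<close> can be moved a little towards \<open>v\<close> within all
  these hyperplanes. It stays in \<open>G\<close>, and \<open>v\<close> is on the line through its
  two positions.\<close>

lemma flat_face:
  assumes G: "G face_of Q" "G \<noteq> {}" "G \<noteq> Q" and "\<not> on_beneath G" "\<not> on_beyond G"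
  shows "convex hull (insert v G) face_of Q'" "convex hull (insert v G) \<inter> Q = G"
    "v \<in> affine hull G"
proof -
  define \<F> where "\<F> = {F. F facet_of Q \<and> G \<subseteq> F}"
  have GF: "G = \<Inter>\<F>"
    unfolding \<F>_def using face_of_polyhedron[OF polyhedron] G by blast
  have fin: "finite \<F>"
    unfolding \<F>_def using finite_facets by simp
  have ne: "\<F> \<noteq> {}"
    using proper_face_subset_facet[OF G(1,3)] unfolding \<F>_def by blast
  have v: "a F \<bullet> v = b F" if "F \<in> \<F>" for F
  proof -
    have F: "F facet_of Q" "G \<subseteq> F"
      using that by (auto simp: \<F>_def)
    then have "\<not> a F \<bullet> v < b F"
      using assms(4) on_beneath_def by blast
    moreover have "\<not> a F \<bullet> v > b F"
      using F assms(5) on_beyond_def by blast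
    ultimately show ?thesis
      by linarith
  qed
  define c where "c = (\<Sum>F\<in>\<F>. a F)"
  define d where "d = (\<Sum>F\<in>\<F>. b F)"
  have slack: "d - c \<bullet> x = (\<Sum>F\<in>\<F>. b F - a F \<bullet> x)" for x
    by (simp add: c_def d_def inner_sum_left sum_subtractf)
  have nn: "b F - a F \<bullet> x \<ge> 0" if "F \<in> \<F>" "x \<in> Q" for x F
    using that facet_le unfolding \<F>_def by simp
  have "c \<bullet> x \<le> d" if "x \<in> Q" for x
    using slack[of x] nn that sum_nonneg[of \<F> "\<lambda>F. b F - a F \<bullet> x"] by simp
  moreover have "c \<bullet> v = d"
    using slack[of v] v by simp
  moreover have "G = Q \<inter> {x. c \<bullet> x = d}"
  proof -
    have "c \<bullet> x = d \<longleftrightarrow> x \<in> G" if "x \<in> Q" for x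
    proof -
      have "c \<bullet> x = d \<longleftrightarrow> (\<Sum>F\<in>\<F>. b F - a F \<bullet> x) = 0"
        using slack[of x] by linarith
      also have "\<dots> \<longleftrightarrow> (\<forall>F\<in>\<F>. b F - a F \<bullet> x = 0)"
        using fin nn that by (intro sum_nonneg_eq_0_iff) auto
      also have "\<dots> \<longleftrightarrow> (\<forall>F\<in>\<F>. x \<in> F)"
        using that mem_facet_iff unfolding \<F>_def by auto
      finally show ?thesis
        using GF by blast
    qed
    then show ?thesis
      using G face_of_imp_subset by blast
  qed
  ultimately show "convex hull (insert v G) face_of Q'" "convex hull (insert v G) \<inter> Q = G"
    using supporting_cone by blast+
  have "rel_interior G \<noteq> {}"
    using G face_of_imp_convex rel_interior_eq_empty by blast
  then obtain x where x: "x \<in> rel_interior G"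
    by blast
  have xG: "x \<in> G"
    using x rel_interior_subset by blast
  have ax: "a F \<bullet> x = b F" if "F \<in> \<F>" for F
    using that xG G face_of_imp_subset mem_facet_iff unfolding \<F>_def by blast
  have "a F \<bullet> (v - x) \<le> 0" if "F facet_of Q" "G \<subseteq> F" for F
    using v[of F] ax[of F] that by (simp add: \<F>_def inner_diff_right)
  then obtain e where e: "e > 0" "x + e *\<^sub>R (v - x) \<in> Q"
    using perturb_rel_interior[OF G(1) x] by blast
  have "x + e *\<^sub>R (v - x) \<in> F" if "F \<in> \<F>" for F
  proof -
    have "a F \<bullet> (x + e *\<^sub>R (v - x)) = b F"
      using v[OF that] ax[OF that] by (simp add: inner_add_right inner_diff_right)
    then show ?thesis
      using e(2) that mem_facet_iff unfolding \<F>_def by blast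
  qed
  then have y: "x + e *\<^sub>R (v - x) \<in> G"
    using GF by blast
  define y where "y = x + e *\<^sub>R (v - x)"
  have "v = (1 - 1 / e) *\<^sub>R x + (1 / e) *\<^sub>R y"
    using e(1) by (simp add: y_def algebra_simps)
  moreover have "(1 - 1 / e) *\<^sub>R x + (1 / e) *\<^sub>R y \<in> affine hull G"
    using xG y y_def by (intro mem_affine[OF affine_affine_hull]) (auto simp: hull_inc)
  ultimately show "v \<in> affine hull G"
    by simp
qed

text \<open>Take a functional that exposes \<open>G'\<close> and move a relative interior point of
  the trace \<open>G\<close>. If \<open>v\<close> is not in \<open>G'\<close> and is beneath no
  facet through \<open>G\<close>, moving away from \<open>v\<close> stays in \<open>Q\<close> but
  raises the functional above its maximum. If \<open>v\<close> is in \<open>G'\<close> and only one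
  sign occurs among the facets through \<open>G\<close>, moving along the line to \<open>v\<close>
  in a suitable direction stays in \<open>G\<close>, so \<open>v\<close> has slack 0 for all these
  facets.\<close>

lemma proper_face_cases:
  assumes G': "G' face_of Q'" "G' \<noteq> Q'"
  defines "G \<equiv> G' \<inter> Q"
  shows "G face_of Q" "G \<noteq> Q"
    and "v \<notin> G' \<Longrightarrow> G' = G \<and> (G \<noteq> {} \<longrightarrow> on_beneath G)"
    and "v \<in> G' \<Longrightarrow> G' = convex hull (insert v G) \<and> (G \<noteq> {} \<longrightarrow> (on_beneath G \<longleftrightarrow> on_beyond G))"
proof -
  have ph: "polyhedron Q'"
    using polytope_Q' polytope_imp_polyhedron by blast
  obtain c d where cd': "\<And>x. x \<in> Q' \<Longrightarrow> c \<bullet> x \<le> d" "G' = Q' \<inter> {x. c \<bullet> x = d}"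
    using face_of_polyhedron_exposing[OF ph G'(1)] by blast
  have cd: "\<And>x. x \<in> Q \<Longrightarrow> c \<bullet> x \<le> d" and GQ: "G = Q \<inter> {x. c \<bullet> x = d}"
    and cv: "c \<bullet> v \<le> d"
    using cd' Q_subset_Q' v_in_Q' unfolding G_def by auto
  show Gf: "G face_of Q"
    unfolding GQ using cd by (intro face_of_Int_supporting_hyperplane_le[OF convex])
  have "convex Q'"
    by (simp add: Q'_def)
  then have "aff_dim G' < aff_dim Q'"
    using face_of_aff_dim_lt G' by blast
  then show "G \<noteq> Q"
    using aff_dim_subset[of G G'] full_dim full_dim_Q' unfolding G_def by force
  have eq: "G' = (if c \<bullet> v = d then convex hull (insert v G) else G)"
    unfolding GQ cd'(2) unfolding Q'_def
    by (rule convex_hull_insert_Int_hyperplane[OF convex Q_nonempty cd cv])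
  have vG': "v \<in> G' \<longleftrightarrow> c \<bullet> v = d"
    using v_in_Q' cd'(2) by blast
  have Gz: "a F \<bullet> x = b F" if "F facet_of Q" "G \<subseteq> F" "x \<in> G" for F x
    using that Gf face_of_imp_subset mem_facet_iff by blast
  have "G \<noteq> {} \<Longrightarrow> \<exists>x. x \<in> rel_interior G \<and> x \<in> G"
    by (metis Gf all_not_in_conv face_of_imp_convex rel_interior_eq_empty rel_interior_subset subsetD)
  then obtain x where x: "G \<noteq> {} \<Longrightarrow> x \<in> rel_interior G" "G \<noteq> {} \<Longrightarrow> x \<in> G"
    by metis
  show "G' = G \<and> (G \<noteq> {} \<longrightarrow> on_beneath G)" if "v \<notin> G'"
  proof (intro conjI impI)
    show "G' = G"
      using eq vG' that by simp
    assume ne: "G \<noteq> {}"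
    show "on_beneath G"
    proof (rule ccontr)
      assume nb: "\<not> on_beneath G"
      have "a F \<bullet> (x - v) \<le> 0" if "F facet_of Q" "G \<subseteq> F" for F
        using that nb Gz[OF that x(2)[OF ne]] unfolding on_beneath_def
        by (auto simp: inner_diff_right not_less)
      then obtain e where e: "e > 0" "x + e *\<^sub>R (x - v) \<in> Q"
        using perturb_rel_interior[OF Gf x(1)[OF ne]] by blast
      have "c \<bullet> x = d"
        using x(2)[OF ne] GQ by blast
      then have "e * (d - c \<bullet> v) \<le> 0"
        using cd[OF e(2)] by (simp add: inner_add_right inner_diff_right)
      then have "c \<bullet> v \<ge> d"
        using e(1) by (simp add: mult_le_0_iff)
      then show False
        using that vG' cv by simp
    qed
  qed
  show "G' = convex hull (insert v G) \<and> (G \<noteq> {} \<longrightarrow> (on_beneath G \<longleftrightarrow> on_beyond G))" if "v \<in> G'"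
  proof (intro conjI impI)
    have v: "c \<bullet> v = d"
      using vG' that by simp
    show "G' = convex hull (insert v G)"
      using eq v by simp
    assume ne: "G \<noteq> {}"
    have xc: "c \<bullet> x = d"
      using x(2)[OF ne] GQ by blast
    \<comment> \<open>The sign 1 moves towards \<open>v\<close>, for the case that \<open>v\<close>
      is beyond no facet through \<open>G\<close>; the sign -1 moves away from \<open>v\<close>, for
      the case that it is beneath none.\<close>
    have move: "a F \<bullet> v = b F"
      if "\<sigma> = 1 \<or> \<sigma> = -1" "F facet_of Q" "G \<subseteq> F"
        and all: "\<And>F. \<lbrakk>F facet_of Q; G \<subseteq> F\<rbrakk> \<Longrightarrow> \<sigma> * (a F \<bullet> v - b F) \<le> 0" for \<sigma> :: real and F
    proof -
      have "a F \<bullet> (\<sigma> *\<^sub>R (v - x)) \<le> 0" if "F facet_of Q" "G \<subseteq> F" for F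
        using all[OF that] Gz[OF that x(2)[OF ne]] by (simp add: inner_diff_right)
      then obtain e where e: "e > 0" "x + e *\<^sub>R (\<sigma> *\<^sub>R (v - x)) \<in> Q"
        using perturb_rel_interior[OF Gf x(1)[OF ne]] by blast
      have "c \<bullet> (x + e *\<^sub>R (\<sigma> *\<^sub>R (v - x))) = d"
        using xc v by (simp add: inner_add_right inner_diff_right)
      then have "x + e *\<^sub>R (\<sigma> *\<^sub>R (v - x)) \<in> G"
        using e GQ by blast
      then have "a F \<bullet> (x + e *\<^sub>R (\<sigma> *\<^sub>R (v - x))) = b F"
        using Gz that by blast
      moreover have "a F \<bullet> x = b F"
        using Gz that x(2)[OF ne] by blast
      ultimately have "e * (\<sigma> * (a F \<bullet> v - b F)) = 0"
        by (simp add: inner_add_right inner_diff_right)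
      then show ?thesis
        using e(1) that(1) by auto
    qed
    show "on_beneath G \<longleftrightarrow> on_beyond G"
    proof (rule ccontr)
      assume "on_beneath G \<noteq> on_beyond G"
      then consider "on_beneath G" "\<not> on_beyond G" | "\<not> on_beneath G" "on_beyond G"
        by blast
      then show False
      proof cases
        case 1
        then obtain F where F: "F facet_of Q" "G \<subseteq> F" "a F \<bullet> v < b F"
          using on_beneath_def by blast
        have "1 * (a F \<bullet> v - b F) \<le> 0" if "F facet_of Q" "G \<subseteq> F" for F
          using 1(2) that unfolding on_beyond_def by (simp add: not_less)
        then show False
          using move[of 1 F] F by simp
      next
        case 2
        then obtain F where F: "F facet_of Q" "G \<subseteq> F" "a F \<bullet> v > b F"
          using on_beyond_def by blast
        have "-1 * (a F \<bullet> v - b F) \<le> 0" if "F facet_of Q" "G \<subseteq> F" for F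
          using 2(1) that unfolding on_beneath_def by (simp add: not_less)
        then show False
          using move[of "-1" F] F by simp
      qed
    qed
  qed
qed

end

section \<open>Counting the faces of the hull\<close>

context beneath_beyond
begin

lemma on_beyond_notin_affine_hull:
  assumes "on_beyond G"
  shows "v \<notin> affine hull G"
proof
  assume v: "v \<in> affine hull G"
  obtain F where F: "F facet_of Q" "G \<subseteq> F" "a F \<bullet> v > b F"
    using assms on_beyond_def by blast
  then have "v \<in> affine hull F"
    using v hull_mono by blast
  then show False
    using affine_hull_facet_subset[OF F(1)] F(3) by auto
qed

text \<open>The bounds on \<open>i\<close> exclude the two faces that do not fit the case
  distinction, the empty one and \<open>Q'\<close> itself. Coning over a face in a facet beyond
  raises the dimension, because \<open>v\<close> is off the hyperplane of that facet.\<close>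

lemma faces_Q'_eq:
  fixes i :: int
  assumes i: "0 \<le> i" "i < DIM('a)"
  shows "{G. G face_of Q' \<and> aff_dim G = i} =
    {G. G face_of Q \<and> aff_dim G = i \<and> on_beneath G} \<union>
    (\<lambda>G. convex hull (insert v G)) `
      ({G. G face_of Q \<and> aff_dim G = i \<and> \<not> on_beneath G \<and> \<not> on_beyond G} \<union>
       {G. G face_of Q \<and> aff_dim G = i - 1 \<and> on_beneath G \<and> on_beyond G})" (is "?L = ?A \<union> ?c ` (?B \<union> ?C)")
proof (intro equalityI subsetI)
  fix G' assume "G' \<in> ?L"
  then have G': "G' face_of Q'" "aff_dim G' = i"
    by auto
  have "G' \<noteq> Q'"
    using G'(2) i full_dim_Q' by auto
  note cs = proper_face_cases[OF G'(1) this]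
  define G where "G = G' \<inter> Q"
  show "G' \<in> ?A \<union> ?c ` (?B \<union> ?C)"
  proof (cases "v \<in> G'")
    case False
    then have G: "G' = G" "G \<noteq> {} \<Longrightarrow> on_beneath G"
      using cs(3) unfolding G_def by blast+
    have "G \<noteq> {}"
      using G(1) G'(2) i by auto
    then have "G' \<in> ?A"
      using G cs(1) G'(2) unfolding G_def by auto
    then show ?thesis ..
  next
    case True
    then have G: "G' = ?c G" "G \<noteq> {} \<Longrightarrow> on_beneath G \<longleftrightarrow> on_beyond G"
      using cs(4) unfolding G_def by blast+
    have dim: "aff_dim (insert v G) = i"
      using G(1) G'(2) by (simp add: aff_dim_convex_hull)
    have Gf: "G face_of Q" "G \<noteq> Q"
      using cs(1,2) unfolding G_def by blast+
    have both: "on_beneath G \<longleftrightarrow> on_beyond G"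
    proof (cases "G = {}")
      case True
      then show ?thesis
        using beneath_ex beyond_ex unfolding on_beneath_def on_beyond_def by blast
    qed (use G in blast)
    have "G \<in> ?B \<union> ?C"
    proof (cases "on_beyond G")
      case True
      then have "aff_dim G = i - 1"
        using on_beyond_notin_affine_hull dim by (simp add: aff_dim_insert aff_dim_convex_hull)
      then show ?thesis
        using True both Gf by blast
    next
      case False
      have "G \<noteq> {}"
        using False beyond_ex unfolding on_beyond_def by blast
      then have "v \<in> affine hull G"
        using flat_face(3) Gf False both by blast
      then have "aff_dim G = i"
        using dim by (simp add: aff_dim_insert aff_dim_convex_hull)
      then show ?thesis
        using False both Gf by blast
    qed
    then show ?thesis
      using G(1) by blast
  qed
next
  fix G' assume "G' \<in> ?A \<union> ?c ` (?B \<union> ?C)"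
  then consider "G' \<in> ?A" | G where "G \<in> ?B" "G' = ?c G" | G where "G \<in> ?C" "G' = ?c G"
    by blast
  then show "G' \<in> ?L"
  proof cases
    case 1
    then show ?thesis
      using on_beneath_face by blast
  next
    case 2
    then have "G \<noteq> {}" "G \<noteq> Q"
      using i full_dim by auto
    then have "?c G face_of Q'" "v \<in> affine hull G"
      using flat_face 2 by blast+
    then show ?thesis
      using 2 by (simp add: aff_dim_insert aff_dim_convex_hull)
  next
    case 3
    then have "v \<notin> affine hull G" "?c G face_of Q'"
      using on_beyond_notin_affine_hull mixed_face by blast+
    then show ?thesis
      using 3 by (simp add: aff_dim_insert aff_dim_convex_hull)
  qed
qed

text \<open>Losses and gains stand on opposite sides to avoid truncated subtraction. The flat faces
  and their cones are equally many by injectivity of coning, and cancel.\<close>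

lemma card_faces_Q':
  fixes i :: int
  assumes i: "0 \<le> i" "i < DIM('a)"
  shows "card {G. G face_of Q' \<and> aff_dim G = i} +
      card {G. G face_of Q \<and> aff_dim G = i \<and> \<not> on_beneath G \<and> on_beyond G} =
    card {G. G face_of Q \<and> aff_dim G = i} +
      card {G. G face_of Q \<and> aff_dim G = i - 1 \<and> on_beneath G \<and> on_beyond G}"
proof -
  define c where "c = (\<lambda>G. convex hull (insert v G))"
  define A where "A = {G. G face_of Q \<and> aff_dim G = i \<and> on_beneath G}"
  define B where "B = {G. G face_of Q \<and> aff_dim G = i \<and> \<not> on_beneath G \<and> \<not> on_beyond G}"
  define C where "C = {G. G face_of Q \<and> aff_dim G = i - 1 \<and> on_beneath G \<and> on_beyond G}"
  define L where "L = {G. G face_of Q \<and> aff_dim G = i \<and> \<not> on_beneath G \<and> on_beyond G}"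
  have fin: "finite {G. G face_of Q}"
    using polytope finite_polytope_faces by blast
  have finite: "finite A" "finite B" "finite C" "finite L"
    unfolding A_def B_def C_def L_def by (rule finite_subset[OF _ fin]; blast)+
  have Int: "c G \<inter> Q = G" if "G \<in> B \<union> C" for G
  proof (cases "G \<in> B")
    case True
    then have "G \<noteq> {}" "G \<noteq> Q"
      using i full_dim by (auto simp: B_def)
    then show ?thesis
      using flat_face(2) True unfolding B_def c_def by blast
  next
    case False
    then show ?thesis
      using that mixed_face(2) unfolding C_def c_def by blast
  qed
  then have "inj_on c (B \<union> C)"
    by (metis inj_onI)
  moreover have "A \<inter> c ` (B \<union> C) = {}"
  proof -
    have "v \<in> c G" for G
      by (simp add: c_def hull_inc)
    moreover have "v \<notin> G" if "G \<in> A" for G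
      using that v_notin face_of_imp_subset unfolding A_def by blast
    ultimately show ?thesis
      by blast
  qed
  moreover have "B \<inter> C = {}"
    by (auto simp: B_def C_def)
  ultimately have "card (A \<union> c ` (B \<union> C)) = card A + (card B + card C)"
    using finite by (simp add: card_Un_disjoint card_image)
  moreover have "{G. G face_of Q' \<and> aff_dim G = i} = A \<union> c ` (B \<union> C)"
    unfolding A_def B_def C_def c_def by (rule faces_Q'_eq[OF i])
  moreover have "card {G. G face_of Q \<and> aff_dim G = i} = card A + card B + card L"
  proof -
    have "{G. G face_of Q \<and> aff_dim G = i} = A \<union> B \<union> L"
      by (auto simp: A_def B_def L_def)
    moreover have "A \<inter> B = {}" "(A \<union> B) \<inter> L = {}"
      by (auto simp: A_def B_def L_def)
    ultimately show ?thesis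
      using finite by (simp add: card_Un_disjoint)
  qed
  ultimately show ?thesis
    unfolding C_def L_def by simp
qed

end

section \<open>Simplex facets in dimension four\<close>

lemma facet_description_exists:
  fixes Q :: "'a::euclidean_space set"
  assumes "polytope Q" "aff_dim Q = DIM('a)"
  obtains a b where "facet_description Q a b"
proof -
  have "\<exists>c d. Q \<subseteq> {x. c \<bullet> x \<le> d} \<and> F = Q \<inter> {x. c \<bullet> x = d}" if "F facet_of Q" for F
    by (metis that assms(1) facet_of_polyhedron polytope_imp_polyhedron)
  then obtain a b where ab: "\<And>F. F facet_of Q \<Longrightarrow> Q \<subseteq> {x. a F \<bullet> x \<le> b F}"
      "\<And>F. F facet_of Q \<Longrightarrow> F = Q \<inter> {x. a F \<bullet> x = b F}"
    by metis
  have "facet_description Q a b"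
    by unfold_locales (use assms ab in blast)+
  then show ?thesis
    using that by blast
qed

lemma convex_hull_subset_Int_affine_independent:
  fixes X :: "'a::euclidean_space set"
  assumes "\<not> affine_dependent X" "Y \<subseteq> X"
  shows "X \<inter> convex hull Y = Y"
proof
  show "X \<inter> convex hull Y \<subseteq> Y"
  proof
    fix x assume x: "x \<in> X \<inter> convex hull Y"
    show "x \<in> Y"
    proof (rule ccontr)
      assume "x \<notin> Y"
      then have "Y \<subseteq> X - {x}"
        using assms by blast
      then have "x \<in> affine hull (X - {x})"
        using x convex_hull_subset_affine_hull[of Y] hull_mono[of Y "X - {x}" affine] by blast
      then show False
        using assms x affine_dependent_def by blast
    qed
  qed
qed (use assms in \<open>auto simp: hull_inc\<close>)

locale simplex_facet =
  fixes Q X :: "pt set"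
  assumes polytope: "polytope Q" and full_dim: "aff_dim Q = 4"
    and indep: "\<not> affine_dependent X" and card: "card X = 4"
    and facet: "convex hull X facet_of Q"
begin

lemma full_dim': "aff_dim Q = DIM(pt)"
  using full_dim by simp

lemma convex: "convex Q"
  using polytope polytope_imp_convex by blast

lemma aff_dim_subset_hull:
  assumes "t \<subseteq> X"
  shows "aff_dim (convex hull t) = int (card t) - 1"
proof -
  have "\<not> affine_dependent t"
    using assms indep affine_independent_subset by blast
  then show ?thesis
    using aff_dim_affine_independent[of t] by (simp add: aff_dim_convex_hull)
qed

lemma face_of_facet: "t \<subseteq> X \<Longrightarrow> convex hull t face_of convex hull X"
  using indep face_of_convex_hull_affine_independent by blast

lemma subset_hull_face: "t \<subseteq> X \<Longrightarrow> convex hull t face_of Q"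
  using face_of_facet facet facet_of_imp_face_of face_of_trans by blast

text \<open>The intersection is a face of the simplex, hence spanned by some of its vertices. These
  include \<open>t\<close> but are not all of \<open>X\<close>, for otherwise one facet would
  contain the other.\<close>

lemma triangle_Int:
  assumes t: "t \<subseteq> X" "card t = 3" and F: "F facet_of Q" "F \<noteq> convex hull X" "t \<subseteq> F"
  shows "F \<inter> convex hull X = convex hull t"
proof -
  have "F \<inter> convex hull X face_of convex hull X"
    using F(1) facet by (meson face_of_Int face_of_subset facet_of_imp_face_of facet_of_imp_subset inf_le2)
  then obtain c where c: "c \<subseteq> X" "F \<inter> convex hull X = convex hull c"
    using indep face_of_convex_hull_affine_independent by blast
  have "t \<subseteq> X \<inter> convex hull c"
    using t(1) F(3) hull_subset[of X convex] unfolding c(2)[symmetric] by blast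
  then have tc: "t \<subseteq> c"
    using convex_hull_subset_Int_affine_independent[OF indep c(1)] by simp
  have "c \<noteq> X"
  proof
    assume "c = X"
    then have "convex hull X \<subseteq> F"
      using c(2) by blast
    then show False
      using F facet facet_subset_facet_eq convex by blast
  qed
  have finX: "finite X"
    using card card.infinite by fastforce
  then have "card c < 4"
    using psubset_card_mono[of X c] c(1) \<open>c \<noteq> X\<close> card by auto
  then have "t = c"
    using card_seteq[of c t] tc t(2) finite_subset[OF c(1) finX] by simp
  then show ?thesis
    using c by simp
qed

lemma facet_across_ex:
  assumes t: "t \<subseteq> X" "card t = 3"
  obtains F where "F facet_of Q" "F \<noteq> convex hull X" "t \<subseteq> F"
proof -
  obtain a b where "facet_description Q a b"
    using facet_description_exists[OF polytope full_dim'] by blast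
  then interpret facet_description Q a b .
  have "aff_dim (convex hull t) \<noteq> aff_dim (convex hull X)"
    using aff_dim_subset_hull[of t] aff_dim_subset_hull[of X] t card by simp
  then have "convex hull t \<noteq> convex hull X"
    by auto
  moreover have "convex hull t \<noteq> {}"
    using t(2) by auto
  moreover have "convex hull t \<subseteq> convex hull X"
    using t by (simp add: hull_mono)
  ultimately obtain F where "F facet_of Q" "F \<noteq> convex hull X" "convex hull t \<subseteq> F"
    using ridge_in_other_facet[OF facet subset_hull_face[OF t(1)]] by blast
  then show ?thesis
    using that hull_subset[of t convex] by blast
qed

lemma facet_across_unique:
  assumes t: "t \<subseteq> X" "card t = 3"
    and F: "F facet_of Q" "F \<noteq> convex hull X" "t \<subseteq> F"
    and F': "F' facet_of Q" "F' \<noteq> convex hull X" "t \<subseteq> F'"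
  shows "F' = F"
proof -
  obtain a b where "facet_description Q a b"
    using facet_description_exists[OF polytope full_dim'] by blast
  then interpret facet_description Q a b .
  have sub: "convex hull t \<subseteq> G" if "G facet_of Q" "t \<subseteq> G" for G
    using that by (meson face_of_imp_convex facet_of_imp_face_of hull_minimal)
  have "aff_dim (convex hull t) = int DIM(pt) - 2"
    using aff_dim_subset_hull[OF t(1)] t(2) by simp
  moreover have "convex hull t \<subseteq> convex hull X"
    using t by (simp add: hull_mono)
  ultimately show ?thesis
    using ridge_at_most_two_facets[OF facet F(1) F'(1), of "convex hull t"] sub F F' by blast
qed

text \<open>The definite description denotes, because a ridge lies in at most two facets and one of
  them is the simplex.\<close>

lemma facet_across_eq:
  assumes t: "t \<subseteq> X" "card t = 3" and F: "F facet_of Q" "F \<noteq> convex hull X" "t \<subseteq> F"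
  shows "facet_across Q (convex hull X) t = F"
  unfolding facet_across_def
proof (rule the_equality)
  show "F facet_of Q \<and> F \<noteq> convex hull X \<and> F \<inter> convex hull X = convex hull t"
    using F triangle_Int[OF t F] by blast
  fix F' assume F': "F' facet_of Q \<and> F' \<noteq> convex hull X \<and> F' \<inter> convex hull X = convex hull t"
  then have "t \<subseteq> F'"
    using hull_subset[of t convex] by blast
  then show "F' = F"
    using facet_across_unique[OF t F] F' by blast
qed

lemma facet_across:
  assumes t: "t \<subseteq> X" "card t = 3"
  shows "facet_across Q (convex hull X) t facet_of Q" "facet_across Q (convex hull X) t \<noteq> convex hull X"
    "t \<subseteq> facet_across Q (convex hull X) t"
proof -
  obtain F where F: "F facet_of Q" "F \<noteq> convex hull X" "t \<subseteq> F"
    using facet_across_ex[OF t] by blast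
  then show "facet_across Q (convex hull X) t facet_of Q" "facet_across Q (convex hull X) t \<noteq> convex hull X"
    "t \<subseteq> facet_across Q (convex hull X) t"
    using facet_across_eq[OF t F] by auto
qed

lemma facet_containing_facet: "F facet_of Q \<Longrightarrow> X \<subseteq> F \<Longrightarrow> F = convex hull X"
  using facet facet_subset_facet_eq[OF convex facet]
  by (metis face_of_imp_convex facet_of_imp_face_of hull_minimal)

text \<open>Being a prescribed neighbour becomes a matter of two inclusions, which the label set of
  the facet decides.\<close>

lemma eq_facet_across_iff:
  assumes t: "t \<subseteq> X" "card t = 3" and F: "F facet_of Q"
  shows "F = facet_across Q (convex hull X) t \<longleftrightarrow> \<not> X \<subseteq> F \<and> t \<subseteq> F"
  using facet_across[OF t] facet_across_eq[OF t F] facet_containing_facet hull_subset[of X convex] F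
  by metis

text \<open>Either triangle spans the whole intersection of \<open>F\<close> with the simplex. Hence
  the neighbours across different triangles are different facets.\<close>

lemma triangles_in_facet_unique:
  assumes t: "t \<subseteq> X" "card t = 3" "t \<subseteq> F" and s: "s \<subseteq> X" "card s = 3" "s \<subseteq> F"
    and F: "F facet_of Q" "\<not> X \<subseteq> F"
  shows "s = t"
proof -
  have "F \<noteq> convex hull X"
    using F(2) hull_subset[of X convex] by blast
  then have "convex hull s = convex hull t"
    using triangle_Int[OF t(1,2) F(1) _ t(3)] triangle_Int[OF s(1,2) F(1) _ s(3)] by simp
  then show ?thesis
    using convex_hull_subset_Int_affine_independent[OF indep] t(1) s(1) by metis
qed

end

lemma facet_affine_hull_Int: "convex Q \<Longrightarrow> F facet_of Q \<Longrightarrow> Q \<inter> affine hull F = F"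
  using face_of_imp_eq_affine_Int facet_of_imp_face_of by (metis inf_commute)

text \<open>Each side condition of a region brings an existentially bound functional of its own. One
  functional per facet is fixed here, taken from the condition on that facet; for facets in
  \<open>FF\<close> any supporting functional serves, since \<open>v\<close> lies in their affine
  hulls.\<close>

lemma region_beneath_beyond:
  fixes Q :: "pt set"
  assumes poly: "polytope Q" "aff_dim Q = 4" and v: "v \<in> region Q T FF NN"
    and T: "T facet_of Q" "T \<notin> FF" "FF \<inter> NN = {}"
    and ex: "\<exists>F. F facet_of Q \<and> F \<noteq> T \<and> F \<notin> FF \<and> F \<notin> NN"
  obtains a b where "beneath_beyond Q a b v"
    "\<And>F. F facet_of Q \<Longrightarrow> a F \<bullet> v > b F \<longleftrightarrow> F = T \<or> F \<in> NN"
    "\<And>F. F facet_of Q \<Longrightarrow> a F \<bullet> v < b F \<longleftrightarrow> F \<noteq> T \<and> F \<notin> NN \<and> F \<notin> FF"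
proof -
  have conv: "convex Q"
    using poly polytope_imp_convex by blast
  define P where "P = (\<lambda>F c d. Q \<subseteq> {x. c \<bullet> x \<le> d} \<and> F = Q \<inter> {x. c \<bullet> x = d} \<and>
      (c \<bullet> v > d \<longleftrightarrow> F = T \<or> F \<in> NN) \<and> (c \<bullet> v < d \<longleftrightarrow> F \<noteq> T \<and> F \<notin> NN \<and> F \<notin> FF))"
  have "\<exists>c d. P F c d" if F: "F facet_of Q" for F
  proof -
    note QF = facet_affine_hull_Int[OF conv F]
    consider "F = T \<or> F \<in> NN" | "F \<noteq> T" "F \<notin> NN" "F \<in> FF" | "F \<noteq> T" "F \<notin> NN" "F \<notin> FF"
      by blast
    then show ?thesis
    proof cases
      case 1
      then have "v \<in> neg_side Q F"
        using v unfolding region_def by blast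
      then obtain c d where "affine hull F = {y. c \<bullet> y = d}" "Q \<subseteq> {y. c \<bullet> y \<le> d}" "c \<bullet> v > d"
        unfolding neg_side_def by blast
      then have "P F c d"
        using 1 QF by (auto simp: P_def)
      then show ?thesis
        by blast
    next
      case 2
      then have vF: "v \<in> affine hull F"
        using v unfolding region_def by blast
      obtain c d where cd: "Q \<subseteq> {x. c \<bullet> x \<le> d}" "F = Q \<inter> {x. c \<bullet> x = d}"
        using facet_of_polyhedron F poly polytope_imp_polyhedron by metis
      have "affine hull F \<subseteq> {x. c \<bullet> x = d}"
        using cd by (intro hull_minimal) (auto simp: affine_hyperplane)
      then have "P F c d"
        using 2 vF cd by (auto simp: P_def)
      then show ?thesis
        by blast
    next
      case 3
      then have "v \<in> pos_side Q F"
        using v F unfolding region_def by blast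
      then obtain c d where "affine hull F = {y. c \<bullet> y = d}" "Q \<subseteq> {y. c \<bullet> y \<le> d}" "c \<bullet> v < d"
        unfolding pos_side_def by blast
      then have "P F c d"
        using 3 QF by (auto simp: P_def)
      then show ?thesis
        by blast
    qed
  qed
  then obtain a b where "\<And>F. F facet_of Q \<Longrightarrow> P F (a F) (b F)"
    by metis
  then have ab: "\<And>F. F facet_of Q \<Longrightarrow> Q \<subseteq> {x. a F \<bullet> x \<le> b F}"
      "\<And>F. F facet_of Q \<Longrightarrow> F = Q \<inter> {x. a F \<bullet> x = b F}"
    and sgn: "\<And>F. F facet_of Q \<Longrightarrow> a F \<bullet> v > b F \<longleftrightarrow> F = T \<or> F \<in> NN"
      "\<And>F. F facet_of Q \<Longrightarrow> a F \<bullet> v < b F \<longleftrightarrow> F \<noteq> T \<and> F \<notin> NN \<and> F \<notin> FF"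
    unfolding P_def by presburger+
  have "beneath_beyond Q a b v"
  proof unfold_locales
    show "aff_dim Q = DIM(pt)"
      using poly by simp
    show "\<And>F x. F facet_of Q \<Longrightarrow> x \<in> Q \<Longrightarrow> a F \<bullet> x \<le> b F"
      using ab(1) by blast
    show "\<exists>F. F facet_of Q \<and> a F \<bullet> v < b F"
      using ex sgn(2) by blast
    show "\<exists>F. F facet_of Q \<and> b F < a F \<bullet> v"
      using T sgn(1) by blast
  qed (use poly ab in blast)+
  then show ?thesis
    using that sgn by blast
qed

section \<open>Label sets of facets\<close>

text \<open>\<open>w\<close> lists the points of a whole construction, of which only the first
  \<open>n\<close> have been placed.\<close>

definition labels :: "(nat \<Rightarrow> pt) \<Rightarrow> nat \<Rightarrow> pt set \<Rightarrow> nat set" where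
  "labels w n F = {j. j < n \<and> w j \<in> F}"

text \<open>Whether the next point lies beneath, on or beyond a facet depends only on the label set of that
  facet. So the family \<open>\<T>\<close> of all label sets, with multiplicities forgotten, suffices to compute the
  facets lost and gained. The family \<open>\<S>\<close> need not contain all simplex facets.\<close>

definition labelled_polytope :: "(nat \<Rightarrow> pt) \<Rightarrow> nat \<Rightarrow> pt set \<Rightarrow> nat set set \<Rightarrow> nat set set \<Rightarrow> bool" where
  "labelled_polytope w n Q \<T> \<S> \<longleftrightarrow>
     polytope Q \<and> aff_dim Q = 4 \<and> inj_on w {..<n} \<and> w ` {..<n} \<subseteq> Q \<and>
     \<T> = labels w n ` {F. F facet_of Q} \<and>
     (\<forall>X\<in>\<S>. card X = 4 \<and> X \<subseteq> {..<n} \<and> \<not> affine_dependent (w ` X) \<and>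
        convex hull (w ` X) facet_of Q \<and> labels w n (convex hull (w ` X)) = X)"

lemma labelled_simplex_facet:
  assumes "labelled_polytope w n Q \<T> \<S>" "X \<in> \<S>"
  shows "simplex_facet Q (w ` X)"
proof -
  have X: "card X = 4" "X \<subseteq> {..<n}" "\<not> affine_dependent (w ` X)" "convex hull (w ` X) facet_of Q"
    and Q: "polytope Q" "aff_dim Q = 4" "inj_on w {..<n}"
    using assms unfolding labelled_polytope_def by simp_all
  have "card (w ` X) = 4"
    using X Q by (metis card_image inj_on_subset)
  then show ?thesis
    using X Q by unfold_locales auto
qed

section \<open>Placing one more labelled point\<close>

definition plus_set :: "nat set set \<Rightarrow> (nat set \<Rightarrow> bool) \<Rightarrow> nat set \<Rightarrow> bool" where
  "plus_set \<T> pos Y \<longleftrightarrow> (\<exists>I\<in>\<T>. Y \<subseteq> I \<and> pos I)"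

lemma facet_of_4_iff: "aff_dim S = 4 \<Longrightarrow> F facet_of S \<longleftrightarrow> F face_of S \<and> aff_dim F = 3"
  by (auto simp: facet_of_def)

text \<open>By \<open>neg_simplex\<close>, each facet that the new point is beyond is a tetrahedron
  on labelled points. Its faces are then hulls of label subsets, and \<open>plus\<close> decides
  which of them lie in a facet that the point is beneath.\<close>

locale placing = beneath_beyond Q a b "w n" for Q :: "pt set" and a b and w :: "nat \<Rightarrow> pt" and n +
  fixes \<T> \<S> :: "nat set set" and pos neg :: "nat set \<Rightarrow> bool"
  assumes labelled: "labelled_polytope w n Q \<T> \<S>"
    and pos_iff: "\<And>F. F facet_of Q \<Longrightarrow> a F \<bullet> w n < b F \<longleftrightarrow> pos (labels w n F)"
    and neg_iff: "\<And>F. F facet_of Q \<Longrightarrow> a F \<bullet> w n > b F \<longleftrightarrow> neg (labels w n F)"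
    and neg_simplex: "\<And>I. I \<in> \<T> \<Longrightarrow> neg I \<Longrightarrow> I \<in> \<S>"
begin

abbreviation plus :: "nat set \<Rightarrow> bool" where
  "plus \<equiv> plus_set \<T> pos"

text \<open>The complex generated by the facets that the new point is beyond, in terms of labels. It
  contains the empty set.\<close>

definition \<D> :: "nat set set" where
  "\<D> = {Y. \<exists>X\<in>\<T>. neg X \<and> Y \<subseteq> X}"

abbreviation hullw :: "nat set \<Rightarrow> pt set" where
  "hullw Y \<equiv> convex hull (w ` Y)"

lemma inj: "inj_on w {..<n}" and points_in: "w ` {..<n} \<subseteq> Q"
  and \<T>_eq: "\<T> = labels w n ` {F. F facet_of Q}"
  using labelled unfolding labelled_polytope_def by simp_all

lemma Bex_\<T>_iff: "(\<exists>I\<in>\<T>. R I) \<longleftrightarrow> (\<exists>F. F facet_of Q \<and> R (labels w n F))"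
  by (subst \<T>_eq) auto

lemma simplexD:
  assumes "X \<in> \<S>"
  shows "card X = 4" "X \<subseteq> {..<n}" "\<not> affine_dependent (w ` X)" "hullw X facet_of Q"
    "labels w n (hullw X) = X"
  using labelled[unfolded labelled_polytope_def] assms by simp_all

lemmas simplex_facet = labelled_simplex_facet[OF labelled]

lemma hullw_subset_iff:
  assumes "F facet_of Q" "Y \<subseteq> {..<n}"
  shows "hullw Y \<subseteq> F \<longleftrightarrow> Y \<subseteq> labels w n F"
proof -
  have "convex F"
    using assms face_of_imp_convex facet_of_imp_face_of by blast
  then have "hullw Y \<subseteq> F \<longleftrightarrow> w ` Y \<subseteq> F"
    by (metis hull_subset subset_hull subset_trans)
  then show ?thesis
    using assms(2) by (auto simp: labels_def)
qed

text \<open>Different facets may share a label set, but not that of a listed simplex, since a facet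
  containing its vertices contains the simplex facet. Forgetting multiplicities is therefore
  harmless for the facets beyond.\<close>

lemma facet_with_simplex_labels:
  assumes F: "F facet_of Q" and X: "labels w n F \<in> \<S>"
  shows "F = hullw (labels w n F)"
proof -
  interpret s: simplex_facet Q "w ` labels w n F"
    using X by (rule simplex_facet)
  show ?thesis
    using s.facet_containing_facet[OF F] by (auto simp: labels_def)
qed

lemma \<D>E:
  assumes "Y \<in> \<D>"
  obtains X where "X \<in> \<S>" "X \<in> \<T>" "neg X" "Y \<subseteq> X" "Y \<subseteq> {..<n}"
proof -
  obtain X where X: "X \<in> \<T>" "neg X" "Y \<subseteq> X"
    using assms unfolding \<D>_def by blast
  have "X \<in> \<S>"
    using neg_simplex X by blast
  moreover have "Y \<subseteq> {..<n}"
    using simplexD(2)[OF \<open>X \<in> \<S>\<close>] X by blast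
  ultimately show ?thesis
    using that X by blast
qed

text \<open>Affine independence of the vertices of a simplex lets its faces be counted as label
  sets: both the dimension and the set itself can be read off.\<close>

lemma \<D>_face:
  assumes "Y \<in> \<D>"
  shows "hullw Y face_of Q" "aff_dim (hullw Y) = int (card Y) - 1" "on_beyond (hullw Y)"
    "\<not> affine_dependent (w ` Y)"
    "labels w n (hullw Y) = Y"
proof -
  obtain X where X: "X \<in> \<S>" "X \<in> \<T>" "neg X" "Y \<subseteq> X" "Y \<subseteq> {..<n}"
    using \<D>E[OF assms] by blast
  interpret s: simplex_facet Q "w ` X"
    using X(1) by (rule simplex_facet)
  have sub: "w ` Y \<subseteq> w ` X"
    using X by blast
  show "hullw Y face_of Q"
    using s.subset_hull_face[OF sub] .
  have "card (w ` Y) = card Y"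
    using X inj by (metis card_image inj_on_subset)
  then show "aff_dim (hullw Y) = int (card Y) - 1"
    using s.aff_dim_subset_hull[OF sub] by simp
  have "hullw Y \<subseteq> hullw X"
    using sub by (rule hull_mono)
  moreover have "a (hullw X) \<bullet> w n > b (hullw X)"
    using neg_iff[OF s.facet] simplexD(5)[OF X(1)] X(3) by simp
  ultimately show "on_beyond (hullw Y)"
    using s.facet unfolding on_beyond_def by blast
  show "\<not> affine_dependent (w ` Y)"
    using s.indep sub affine_independent_subset by blast
  show "labels w n (hullw Y) = Y"
  proof
    show "Y \<subseteq> labels w n (hullw Y)"
      using X(5) hull_subset[of "w ` Y" convex] by (auto simp: labels_def)
    show "labels w n (hullw Y) \<subseteq> Y"
    proof
      fix j assume j: "j \<in> labels w n (hullw Y)"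
      then have "j \<in> labels w n (hullw X)"
        using hull_mono[OF sub, of convex] by (auto simp: labels_def)
      then have "j \<in> X"
        using simplexD(5)[OF X(1)] by simp
      then have "w j \<in> w ` X \<inter> hullw Y"
        using j by (auto simp: labels_def)
      then have "w j \<in> w ` Y"
        using convex_hull_subset_Int_affine_independent[OF s.indep sub] by simp
      then show "j \<in> Y"
        using inj j X(5) by (auto simp: labels_def inj_on_def)
    qed
  qed
qed

lemma on_beneath_hullw:
  assumes "Y \<subseteq> {..<n}"
  shows "on_beneath (hullw Y) \<longleftrightarrow> plus Y"
proof -
  have "F facet_of Q \<and> hullw Y \<subseteq> F \<and> a F \<bullet> w n < b F \<longleftrightarrow>
      F facet_of Q \<and> Y \<subseteq> labels w n F \<and> pos (labels w n F)" for F
    using hullw_subset_iff[OF _ assms] pos_iff by auto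
  then show ?thesis
    unfolding on_beneath_def plus_set_def Bex_\<T>_iff by simp
qed

lemma inj_on_hullw: "inj_on hullw \<D>"
proof (rule inj_on_inverseI)
  show "\<And>Y. Y \<in> \<D> \<Longrightarrow> labels w n (hullw Y) = Y"
    by (rule \<D>_face(5))
qed

lemma on_beyond_faces:
  assumes "G face_of Q" "on_beyond G"
  obtains Y where "Y \<in> \<D>" "G = hullw Y"
proof -
  obtain F where F: "F facet_of Q" "G \<subseteq> F" "a F \<bullet> w n > b F"
    using assms on_beyond_def by blast
  define X where "X = labels w n F"
  have X: "X \<in> \<T>" "neg X"
    using F neg_iff unfolding X_def \<T>_eq by blast+
  then have "X \<in> \<S>"
    using neg_simplex by blast
  then interpret s: simplex_facet Q "w ` X"
    by (rule simplex_facet)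
  have "F = hullw X"
    using facet_with_simplex_labels F(1) \<open>X \<in> \<S>\<close> unfolding X_def by blast
  then have "G face_of hullw X"
    using assms F by (metis face_of_subset facet_of_imp_subset)
  then obtain c where c: "c \<subseteq> w ` X" "G = convex hull c"
    using s.indep face_of_convex_hull_affine_independent by blast
  then obtain Y where "Y \<subseteq> X" "c = w ` Y"
    by (meson subset_imageE)
  then show ?thesis
    using that X c unfolding \<D>_def by blast
qed

text \<open>\<open>R\<close> is negation for the faces that disappear and the identity for those
  that are coned. A face of dimension \<open>k - 1\<close> has \<open>k\<close> labels.\<close>

lemma on_beyond_faces_eq:
  "{G. G face_of Q \<and> aff_dim G = int k - 1 \<and> R (on_beneath G) \<and> on_beyond G} =
    hullw ` {Y \<in> \<D>. card Y = k \<and> R (plus Y)}" (is "?L = ?R")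
proof
  show "?L \<subseteq> ?R"
  proof
    fix G assume G: "G \<in> ?L"
    then obtain Y where Y: "Y \<in> \<D>" "G = hullw Y"
      using on_beyond_faces by blast
    have "Y \<subseteq> {..<n}"
      using \<D>E[OF Y(1)] by blast
    then show "G \<in> ?R"
      using G Y \<D>_face(2)[OF Y(1)] on_beneath_hullw by auto
  qed
  show "?R \<subseteq> ?L"
  proof
    fix G assume "G \<in> ?R"
    then obtain Y where Y: "Y \<in> \<D>" "card Y = k" "R (plus Y)" "G = hullw Y"
      by blast
    have "Y \<subseteq> {..<n}"
      using \<D>E[OF Y(1)] by blast
    then show "G \<in> ?L"
      using Y \<D>_face[OF Y(1)] on_beneath_hullw by auto
  qed
qed

lemma card_on_beyond_faces:
  "card {G. G face_of Q \<and> aff_dim G = int k - 1 \<and> R (on_beneath G) \<and> on_beyond G} =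
    card {Y \<in> \<D>. card Y = k \<and> R (plus Y)}"
  unfolding on_beyond_faces_eq
  by (intro card_image inj_on_subset[OF inj_on_hullw]) auto

lemma card_faces_step:
  assumes "k < 4"
  shows "card {G. G face_of Q' \<and> aff_dim G = int k} + card {Y \<in> \<D>. card Y = Suc k \<and> \<not> plus Y} =
    card {G. G face_of Q \<and> aff_dim G = int k} + card {Y \<in> \<D>. card Y = k \<and> plus Y}"
proof -
  have "card {G. G face_of Q \<and> aff_dim G = int k \<and> \<not> on_beneath G \<and> on_beyond G} =
      card {Y \<in> \<D>. card Y = Suc k \<and> \<not> plus Y}"
    using card_on_beyond_faces[of "Suc k" Not] by simp
  moreover have "card {G. G face_of Q \<and> aff_dim G = int k - 1 \<and> on_beneath G \<and> on_beyond G} =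
      card {Y \<in> \<D>. card Y = k \<and> plus Y}"
    using card_on_beyond_faces[of k "\<lambda>x. x"] .
  ultimately show ?thesis
    using card_faces_Q'[of "int k"] assms by simp
qed

abbreviation cone :: "pt set \<Rightarrow> pt set" where
  "cone G \<equiv> convex hull (insert (w n) G)"

text \<open>No facet contains another, so whether a facet is \<open>on_beneath\<close> or
  \<open>on_beyond\<close> depends only on its own sign.\<close>

lemma facets_Q'_eq:
  "{F. F facet_of Q'} =
    {F. F facet_of Q \<and> pos (labels w n F)} \<union>
    cone ` {F. F facet_of Q \<and> \<not> pos (labels w n F) \<and> \<not> neg (labels w n F)} \<union>
    cone ` hullw ` {Y \<in> \<D>. card Y = 3 \<and> plus Y}"
proof -
  have Q4: "aff_dim Q = 4" "aff_dim Q' = 4"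
    using full_dim full_dim_Q' by auto
  have sub: "F facet_of Q \<Longrightarrow> G facet_of Q \<Longrightarrow> F \<subseteq> G \<longleftrightarrow> F = G" for F G
    using facet_subset_facet_eq convex by blast
  have beneath: "on_beneath F \<longleftrightarrow> pos (labels w n F)" if "F facet_of Q" for F
    using that sub pos_iff unfolding on_beneath_def by blast
  have beyond: "on_beyond F \<longleftrightarrow> neg (labels w n F)" if "F facet_of Q" for F
    using that sub neg_iff unfolding on_beyond_def by blast
  have "{F. F facet_of Q'} = {F. F face_of Q' \<and> aff_dim F = 3}"
    using facet_of_4_iff Q4 by blast
  also have "\<dots> = {G. G face_of Q \<and> aff_dim G = 3 \<and> on_beneath G} \<union>
    cone ` ({G. G face_of Q \<and> aff_dim G = 3 \<and> \<not> on_beneath G \<and> \<not> on_beyond G} \<union>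
       {G. G face_of Q \<and> aff_dim G = 3 - 1 \<and> on_beneath G \<and> on_beyond G})"
    by (rule faces_Q'_eq) auto
  also have "{G. G face_of Q \<and> aff_dim G = 3 \<and> on_beneath G} =
      {F. F facet_of Q \<and> pos (labels w n F)}"
    using facet_of_4_iff[OF Q4(1)] beneath by blast
  also have "{G. G face_of Q \<and> aff_dim G = 3 \<and> \<not> on_beneath G \<and> \<not> on_beyond G} =
      {F. F facet_of Q \<and> \<not> pos (labels w n F) \<and> \<not> neg (labels w n F)}"
    using facet_of_4_iff[OF Q4(1)] beneath beyond by blast
  also have "{G. G face_of Q \<and> aff_dim G = 3 - 1 \<and> on_beneath G \<and> on_beyond G} =
      hullw ` {Y \<in> \<D>. card Y = 3 \<and> plus Y}"
    using on_beyond_faces_eq[of 3 "\<lambda>x. x"] by simp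
  finally show ?thesis
    unfolding image_Un Un_assoc .
qed

lemma labels_cone:
  assumes "cone G \<inter> Q = G"
  shows "labels w (Suc n) (cone G) = insert n (labels w n G)"
proof -
  have "w n \<in> cone G"
    by (simp add: hull_inc)
  moreover have "w j \<in> cone G \<longleftrightarrow> w j \<in> G" if "j < n" for j
    using assms points_in that by blast
  ultimately show ?thesis
    by (auto simp: labels_def less_Suc_eq)
qed

lemma labels_old: "F facet_of Q \<Longrightarrow> labels w (Suc n) F = labels w n F"
  using v_notin facet_of_imp_subset[of F Q] by (auto simp: labels_def less_Suc_eq)

text \<open>The transition rule for label families. The cone over a triangle in \<D> is a simplex,
  because the new point is off the hyperplane of a facet through that triangle. Simplices whose
  hyperplane contains the new point leave the list, as their cones carry five labels.\<close>

lemma labelled_step: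
  "labelled_polytope w (Suc n) Q'
    ({I \<in> \<T>. pos I} \<union> insert n ` {I \<in> \<T>. \<not> pos I \<and> \<not> neg I} \<union> insert n ` {Y \<in> \<D>. card Y = 3 \<and> plus Y})
    ({I \<in> \<S>. pos I} \<union> insert n ` {Y \<in> \<D>. card Y = 3 \<and> plus Y})"
  (is "labelled_polytope _ _ _ ?\<T>' ?\<S>'")
proof -
  have flat_Int: "cone F \<inter> Q = F" if "F facet_of Q" "\<not> pos (labels w n F)" "\<not> neg (labels w n F)" for F
  proof (rule flat_face(2))
    show "F face_of Q" "F \<noteq> {}" "F \<noteq> Q"
      using that(1) by (auto simp: facet_of_imp_face_of facet_of_def)
    have sub: "F \<subseteq> G \<longleftrightarrow> F = G" if "G facet_of Q" for G
      using facet_subset_facet_eq convex that \<open>F facet_of Q\<close> by blast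
    show "\<not> on_beneath F"
      using that sub pos_iff unfolding on_beneath_def by blast
    show "\<not> on_beyond F"
      using that sub neg_iff unfolding on_beyond_def by blast
  qed
  have cone_Int: "cone (hullw Y) \<inter> Q = hullw Y" if "Y \<in> \<D>" "plus Y" for Y
  proof (rule mixed_face(2))
    have "Y \<subseteq> {..<n}"
      using \<D>E[OF that(1)] by blast
    then show "on_beneath (hullw Y)"
      using that on_beneath_hullw by blast
  qed (use \<D>_face that in blast)+
  have facets: "labels w (Suc n) ` {F. F facet_of Q'} = ?\<T>'"
  proof -
    have "labels w (Suc n) ` {F. F facet_of Q \<and> pos (labels w n F)} = {I \<in> \<T>. pos I}"
      unfolding \<T>_eq using labels_old by (auto simp: image_iff)
    moreover have "labels w (Suc n) ` cone ` {F. F facet_of Q \<and> \<not> pos (labels w n F) \<and> \<not> neg (labels w n F)} =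
        insert n ` {I \<in> \<T>. \<not> pos I \<and> \<not> neg I}"
    proof -
      have "labels w (Suc n) ` cone ` {F. F facet_of Q \<and> \<not> pos (labels w n F) \<and> \<not> neg (labels w n F)} =
        (\<lambda>F. insert n (labels w n F)) ` {F. F facet_of Q \<and> \<not> pos (labels w n F) \<and> \<not> neg (labels w n F)}"
        unfolding image_image using labels_cone flat_Int by (intro image_cong) auto
      also have "\<dots> = insert n ` {I \<in> \<T>. \<not> pos I \<and> \<not> neg I}"
        unfolding \<T>_eq by blast
      finally show ?thesis .
    qed
    moreover have "labels w (Suc n) ` cone ` hullw ` {Y \<in> \<D>. card Y = 3 \<and> plus Y} =
        insert n ` {Y \<in> \<D>. card Y = 3 \<and> plus Y}"
      unfolding image_image using labels_cone cone_Int \<D>_face(5) by (intro image_cong) auto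
    ultimately show ?thesis
      unfolding facets_Q'_eq image_Un by simp
  qed
  have inj': "inj_on w {..<Suc n}"
    using inj points_in v_notin by (auto simp: lessThan_Suc)
  have points: "w ` {..<Suc n} \<subseteq> Q'"
    using points_in Q_subset_Q' v_in_Q' by (auto simp: lessThan_Suc)
  have simplices: "card X = 4 \<and> X \<subseteq> {..<Suc n} \<and> \<not> affine_dependent (w ` X) \<and>
        hullw X facet_of Q' \<and> labels w (Suc n) (hullw X) = X" if XS: "X \<in> ?\<S>'" for X
  proof (cases "X \<in> {I \<in> \<S>. pos I}")
    case True
    then have X: "X \<in> \<S>" "pos X"
      by auto
    have "hullw X \<in> {F. F facet_of Q \<and> pos (labels w n F)}"
      using simplexD(4,5)[OF X(1)] X(2) by simp
    then have "hullw X \<in> {F. F facet_of Q'}"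
      unfolding facets_Q'_eq by blast
    then show ?thesis
      using simplexD[OF X(1)] labels_old[of "hullw X"] by (auto simp: lessThan_Suc)
  next
    case False
    then obtain Y where Y: "Y \<in> \<D>" "card Y = 3" "plus Y" "X = insert n Y"
      using XS by blast
    have Yn: "Y \<subseteq> {..<n}"
      using \<D>E[OF Y(1)] by blast
    then have "finite Y" "n \<notin> Y"
      using finite_subset by blast+
    then have "card X = 4"
      using Y by simp
    have eq: "hullw X = cone (hullw Y)"
      using Y(4) hull_insert[of convex "w n" "w ` Y"] by simp
    have "w n \<notin> affine hull (hullw Y)"
      using on_beyond_notin_affine_hull \<D>_face(3)[OF Y(1)] by blast
    then have "w n \<notin> affine hull (w ` Y)"
      by simp
    then have "\<not> affine_dependent (w ` X)"
      using affine_independent_insert \<D>_face(4)[OF Y(1)] Y(4) by simp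
    moreover have "hullw X facet_of Q'"
    proof -
      have "hullw X \<in> cone ` hullw ` {Y \<in> \<D>. card Y = 3 \<and> plus Y}"
        unfolding eq using Y by blast
      then have "hullw X \<in> {F. F facet_of Q'}"
        unfolding facets_Q'_eq by blast
      then show ?thesis
        by simp
    qed
    moreover have "labels w (Suc n) (hullw X) = X"
      using labels_cone cone_Int Y \<D>_face(5) eq by simp
    ultimately show ?thesis
      using \<open>card X = 4\<close> Y(4) Yn by auto
  qed
  show ?thesis
    unfolding labelled_polytope_def
    using full_dim_Q' facets by (intro conjI ballI simplices polytope_Q' inj' points) simp_all
qed

end

section \<open>Regions in terms of label sets\<close>

definition beyond :: "nat set \<Rightarrow> nat set set \<Rightarrow> nat set \<Rightarrow> bool" where
  "beyond X nn I \<longleftrightarrow> X \<subseteq> I \<or> (\<exists>t\<in>nn. t \<subseteq> I)"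

text \<open>Containing \<open>X\<close> identifies the simplex facet, and containing a triangle of
  \<open>X\<close> but not \<open>X\<close> identifies the facet across that triangle. The
  conditions of a region thus become inclusions.\<close>

definition beneath :: "nat set \<Rightarrow> nat set set \<Rightarrow> nat set set \<Rightarrow> nat set \<Rightarrow> bool" where
  "beneath X tt nn I \<longleftrightarrow> \<not> X \<subseteq> I \<and> (\<forall>t\<in>tt \<union> nn. \<not> t \<subseteq> I)"

lemma labelled_polytope_mono:
  "labelled_polytope w n Q \<T> \<S> \<Longrightarrow> \<S>' \<subseteq> \<S> \<Longrightarrow> labelled_polytope w n Q \<T> \<S>'"
  unfolding labelled_polytope_def by blast

lemma image_subset_iff_labels:
  assumes "Y \<subseteq> {..<n}"
  shows "w ` Y \<subseteq> F \<longleftrightarrow> Y \<subseteq> labels w n F"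
  using assms by (auto simp: labels_def)

text \<open>The witness is the label set of the facet across \<open>t\<close>, which meets the
  simplex in this triangle alone.\<close>

lemma labelled_triangle_ex:
  assumes L: "labelled_polytope w n Q \<T> \<S>" "X \<in> \<S>" and t: "t \<subseteq> X" "card t = 3"
  obtains I where "I \<in> \<T>" "\<not> X \<subseteq> I" "t \<subseteq> I" "\<And>s. s \<subseteq> X \<Longrightarrow> card s = 3 \<Longrightarrow> s \<subseteq> I \<Longrightarrow> s = t"
proof -
  interpret s: simplex_facet Q "w ` X"
    using L by (rule labelled_simplex_facet)
  have inj: "inj_on w {..<n}" and X: "X \<subseteq> {..<n}" and \<T>: "\<T> = labels w n ` {F. F facet_of Q}"
    using L unfolding labelled_polytope_def by simp_all
  have img: "w ` s \<subseteq> w ` X" "card (w ` s) = 3" if "s \<subseteq> X" "card s = 3" for s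
    using that card_image[of w s] inj_on_subset[OF inj] X by auto
  obtain F where F: "F facet_of Q" "F \<noteq> convex hull (w ` X)" "w ` t \<subseteq> F"
    using s.facet_across_ex img[OF t] by blast
  have nX: "\<not> w ` X \<subseteq> F"
    using F s.facet_containing_facet by blast
  show ?thesis
  proof
    show "labels w n F \<in> \<T>"
      using \<T> F(1) by blast
    show "\<not> X \<subseteq> labels w n F"
      using nX image_subset_iff_labels[OF X] by blast
    show "t \<subseteq> labels w n F"
      using F(3) image_subset_iff_labels t X by (metis subset_trans)
    show "s = t" if s: "s \<subseteq> X" "card s = 3" "s \<subseteq> labels w n F" for s
    proof -
      have "w ` s \<subseteq> F"
        using s image_subset_iff_labels X by (metis subset_trans)
      then have "w ` s = w ` t"
        using s.triangles_in_facet_unique[OF img[OF t] F(3) img[OF s(1,2)] _ F(1) nX] by blast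
      then show ?thesis
        using inj_on_image_eq_iff[OF inj] s(1) t(1) X by (meson subset_trans)
    qed
  qed
qed

lemma labelled_superset_simplex:
  assumes L: "labelled_polytope w n Q \<T> \<S>" "X \<in> \<S>" and I: "I \<in> \<T>" "X \<subseteq> I"
  shows "I = X"
proof -
  interpret s: simplex_facet Q "w ` X"
    using L by (rule labelled_simplex_facet)
  have X: "X \<subseteq> {..<n}" "labels w n (convex hull (w ` X)) = X" and \<T>: "\<T> = labels w n ` {F. F facet_of Q}"
    using L unfolding labelled_polytope_def by simp_all
  obtain F where F: "F facet_of Q" "I = labels w n F"
    using I \<T> by blast
  then have "w ` X \<subseteq> F"
    using I image_subset_iff_labels[OF X(1)] by blast
  then have "F = convex hull (w ` X)"
    using s.facet_containing_facet F by blast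
  then show ?thesis
    using F X by simp
qed

lemma simplex_in_labels:
  assumes "labelled_polytope w n Q \<T> \<S>" "X \<in> \<S>"
  shows "X \<in> \<T>"
proof -
  have X: "convex hull (w ` X) facet_of Q" "labels w n (convex hull (w ` X)) = X"
      and \<T>: "\<T> = labels w n ` {F. F facet_of Q}"
    using assms unfolding labelled_polytope_def by simp_all
  have "labels w n (convex hull (w ` X)) \<in> \<T>"
    using X(1) \<T> by blast
  then show ?thesis
    using X(2) by simp
qed

text \<open>The passage from geometry to labels. Facets across different triangles are different, so
  disjointness of \<open>tt\<close> and \<open>nn\<close> carries over to the facets, and
  \<open>ex\<close> provides a facet that the new point is beneath.\<close>

lemma region_placing:
  assumes L: "labelled_polytope w n Q \<T> \<S>" "X \<in> \<S>"
    and tt: "\<And>t. t \<in> tt \<Longrightarrow> t \<subseteq> X \<and> card t = 3" and nn: "\<And>t. t \<in> nn \<Longrightarrow> t \<subseteq> X \<and> card t = 3"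
    and disj: "tt \<inter> nn = {}"
    and reg: "w n \<in> region Q (convex hull (w ` X))
      ((\<lambda>t. facet_across Q (convex hull (w ` X)) (w ` t)) ` tt)
      ((\<lambda>t. facet_across Q (convex hull (w ` X)) (w ` t)) ` nn)"
    and ex: "\<exists>I\<in>\<T>. beneath X tt nn I"
    and simplices: "\<And>I. I \<in> \<T> \<Longrightarrow> beyond X nn I \<Longrightarrow> I \<in> \<S>"
  obtains a b where "placing Q a b w n \<T> \<S> (beneath X tt nn) (beyond X nn)"
proof -
  define T where "T = convex hull (w ` X)"
  define A where "A = (\<lambda>t. facet_across Q T (w ` t))"
  interpret s: simplex_facet Q "w ` X"
    using L by (rule labelled_simplex_facet)
  have inj: "inj_on w {..<n}" and X: "X \<subseteq> {..<n}" and \<T>: "\<T> = labels w n ` {F. F facet_of Q}"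
    using L unfolding labelled_polytope_def by simp_all
  have img: "w ` t \<subseteq> w ` X" "card (w ` t) = 3" if "t \<in> tt \<union> nn" for t
  proof -
    have t: "t \<subseteq> X" "card t = 3"
      using that tt nn by auto
    then have "inj_on w t"
      using inj_on_subset[OF inj] X by auto
    then show "w ` t \<subseteq> w ` X" "card (w ` t) = 3"
      using t card_image[of w t] by auto
  qed
  have tri: "t \<subseteq> {..<n}" if "t \<in> tt \<union> nn" for t
    using that tt nn X by blast
  have eq_T: "F = T \<longleftrightarrow> X \<subseteq> labels w n F" if "F facet_of Q" for F
    using s.facet_containing_facet[OF that] image_subset_iff_labels[OF X, of w F]
      hull_subset[of "w ` X" convex] unfolding T_def by blast
  have eq_A: "F = A t \<longleftrightarrow> \<not> X \<subseteq> labels w n F \<and> t \<subseteq> labels w n F"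
    if "F facet_of Q" "t \<in> tt \<union> nn" for F t
    using s.eq_facet_across_iff[OF img[OF that(2)] that(1)]
      image_subset_iff_labels[OF X, of w F] image_subset_iff_labels[OF tri[OF that(2)], of w F]
    unfolding A_def T_def by simp
  have A_facet: "A t facet_of Q" "A t \<noteq> T" if "t \<in> tt \<union> nn" for t
    using s.facet_across[OF img[OF that]] unfolding A_def T_def by auto
  have "A t \<noteq> A u" if t: "t \<in> tt" and u: "u \<in> nn" for t u
  proof
    assume eq: "A t = A u"
    have t': "t \<in> tt \<union> nn" and u': "u \<in> tt \<union> nn"
      using t u by auto
    have F: "A t facet_of Q" "\<not> w ` X \<subseteq> A t"
      using A_facet[OF t'] s.facet_containing_facet unfolding T_def by blast+
    have "w ` t \<subseteq> A t" "w ` u \<subseteq> A t"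
      using s.facet_across(3)[OF img[OF t']] s.facet_across(3)[OF img[OF u']] eq
      unfolding A_def T_def by auto
    then have "w ` u = w ` t"
      using s.triangles_in_facet_unique[OF img[OF t'] _ img[OF u'] _ F] by blast
    then have "u = t"
      using inj_on_image_eq_iff[OF inj] tri t' u' by blast
    then show False
      using disj t u by blast
  qed
  then have disj': "A ` tt \<inter> A ` nn = {}"
    by blast
  have TA: "T \<notin> A ` tt"
    using A_facet by blast
  obtain F where F: "F facet_of Q" "beneath X tt nn (labels w n F)"
    using ex \<T> by blast
  then have "F facet_of Q \<and> F \<noteq> T \<and> F \<notin> A ` tt \<and> F \<notin> A ` nn"
    using eq_T eq_A unfolding beneath_def by blast
  then have ex': "\<exists>F. F facet_of Q \<and> F \<noteq> T \<and> F \<notin> A ` tt \<and> F \<notin> A ` nn"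
    by blast
  have reg': "w n \<in> region Q T (A ` tt) (A ` nn)"
    using reg unfolding A_def T_def .
  have T: "T facet_of Q"
    using s.facet unfolding T_def .
  obtain a b where ab: "beneath_beyond Q a b (w n)"
    "\<And>F. F facet_of Q \<Longrightarrow> a F \<bullet> w n > b F \<longleftrightarrow> F = T \<or> F \<in> A ` nn"
    "\<And>F. F facet_of Q \<Longrightarrow> a F \<bullet> w n < b F \<longleftrightarrow> F \<noteq> T \<and> F \<notin> A ` nn \<and> F \<notin> A ` tt"
    using region_beneath_beyond[OF s.polytope s.full_dim reg' T TA disj' ex'] by blast
  interpret bb: beneath_beyond Q a b "w n"
    by (rule ab(1))
  have "placing Q a b w n \<T> \<S> (beneath X tt nn) (beyond X nn)"
  proof unfold_locales
    fix F assume F: "F facet_of Q"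
    have mem: "F \<in> A ` uu \<longleftrightarrow> \<not> X \<subseteq> labels w n F \<and> (\<exists>t\<in>uu. t \<subseteq> labels w n F)"
      if "uu \<subseteq> tt \<union> nn" for uu
      using eq_A[OF F] that by (auto simp: image_iff)
    show "a F \<bullet> w n < b F \<longleftrightarrow> beneath X tt nn (labels w n F)"
      unfolding ab(3)[OF F] eq_T[OF F] mem[OF Un_upper1] mem[OF Un_upper2] beneath_def by blast
    show "a F \<bullet> w n > b F \<longleftrightarrow> beyond X nn (labels w n F)"
      unfolding ab(2)[OF F] eq_T[OF F] mem[OF Un_upper2] beyond_def by blast
  qed (use L simplices in auto)
  then show ?thesis
    using that by blast
qed

text \<open>\<open>D\<close> is the complex of the facets beyond, \<open>N\<close> its part in
  facets beneath. A lost face of dimension \<open>k\<close> is a set of \<open>k + 1\<close> labels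
  in \<open>D - N\<close>; a new one that is not the cone of a flat face is the cone over
  \<open>k\<close> labels in \<open>N\<close>.\<close>

lemma region_step:
  assumes L: "labelled_polytope w n Q \<T> \<S>" "X \<in> \<S>"
    and tt: "\<And>t. t \<in> tt \<Longrightarrow> t \<subseteq> X \<and> card t = 3" and nn: "\<And>t. t \<in> nn \<Longrightarrow> t \<subseteq> X \<and> card t = 3"
    and disj: "tt \<inter> nn = {}"
    and reg: "w n \<in> region Q (convex hull (w ` X))
      ((\<lambda>t. facet_across Q (convex hull (w ` X)) (w ` t)) ` tt)
      ((\<lambda>t. facet_across Q (convex hull (w ` X)) (w ` t)) ` nn)"
    and ex: "\<exists>I\<in>\<T>. beneath X tt nn I"
    and simplices: "\<And>I. I \<in> \<T> \<Longrightarrow> beyond X nn I \<Longrightarrow> I \<in> \<S>"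
    and D: "D = {Y. \<exists>I\<in>\<T>. beyond X nn I \<and> Y \<subseteq> I}"
    and N: "N = {Y \<in> D. plus_set \<T> (beneath X tt nn) Y}"
  shows "labelled_polytope w (Suc n) (add_pt Q (w n))
      ({I \<in> \<T>. beneath X tt nn I} \<union> insert n ` {I \<in> \<T>. \<not> beneath X tt nn I \<and> \<not> beyond X nn I} \<union>
        insert n ` {Y \<in> N. card Y = 3})
      ({I \<in> \<S>. beneath X tt nn I} \<union> insert n ` {Y \<in> N. card Y = 3})"
    and "\<And>k. k < 4 \<Longrightarrow> fvec (add_pt Q (w n)) ! k + card {Y \<in> D - N. card Y = Suc k} =
      fvec Q ! k + card {Y \<in> N. card Y = k}"
proof -
  obtain a b where "placing Q a b w n \<T> \<S> (beneath X tt nn) (beyond X nn)"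
    by (rule region_placing[OF L tt nn disj reg ex simplices])
  then interpret placing Q a b w n \<T> \<S> "beneath X tt nn" "beyond X nn" .
  have Q'_eq: "Q' = add_pt Q (w n)"
    unfolding Q'_def add_pt_def by simp
  have D_eq: "\<D> = D"
    unfolding D \<D>_def ..
  have *: "{Y \<in> D. card Y = k \<and> plus Y} = {Y \<in> N. card Y = k}"
    "{Y \<in> D. card Y = k \<and> \<not> plus Y} = {Y \<in> D - N. card Y = k}" for k
    unfolding N by auto
  show "labelled_polytope w (Suc n) (add_pt Q (w n))
      ({I \<in> \<T>. beneath X tt nn I} \<union> insert n ` {I \<in> \<T>. \<not> beneath X tt nn I \<and> \<not> beyond X nn I} \<union>
        insert n ` {Y \<in> N. card Y = 3})
      ({I \<in> \<S>. beneath X tt nn I} \<union> insert n ` {Y \<in> N. card Y = 3})"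
    using labelled_step unfolding Q'_eq D_eq * .
  show "fvec (add_pt Q (w n)) ! k + card {Y \<in> D - N. card Y = Suc k} =
      fvec Q ! k + card {Y \<in> N. card Y = k}" if "k < 4" for k
  proof -
    have "fvec S ! k = card {F. F face_of S \<and> aff_dim F = int k}" for S
      using that by (auto simp: fvec_def less_Suc_eq numeral_eq_Suc)
    then show ?thesis
      using card_faces_step[OF that] unfolding Q'_eq D_eq * by simp
  qed
qed

lemma fvec_add_eqI:
  assumes "\<And>k. k < 4 \<Longrightarrow> fvec Q' ! k = fvec Q ! k + d ! k" "length d = 4"
  shows "fvec Q' = map2 (+) (fvec Q) d"
  using assms by (intro nth_equalityI) (auto simp: fvec_def)

text \<open>A triangle of \<open>X\<close> lies in only two facets, so it survives iff the new point is beneath the facet across it.\<close>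

lemma single_step:
  assumes L: "labelled_polytope w n Q \<T> \<S>" "X \<in> \<S>"
    and tt: "\<And>t. t \<in> tt \<Longrightarrow> t \<subseteq> X \<and> card t = 3" "card tt \<le> 3"
    and reg: "w n \<in> region Q (convex hull (w ` X))
      ((\<lambda>t. facet_across Q (convex hull (w ` X)) (w ` t)) ` tt) {}"
    and edges: "\<And>e. e \<subseteq> X \<Longrightarrow> card e = 2 \<Longrightarrow> \<exists>I\<in>\<T>. e \<subseteq> I \<and> beneath X tt {} I"
  shows "labelled_polytope w (Suc n) (add_pt Q (w n))
      ({I \<in> \<T>. beneath X tt {} I} \<union> insert n ` {I \<in> \<T>. \<not> X \<subseteq> I \<and> (\<exists>t\<in>tt. t \<subseteq> I)} \<union>
        insert n ` {t. t \<subseteq> X \<and> card t = 3 \<and> (\<forall>s\<in>tt. \<not> s \<subseteq> t)})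
      ({I \<in> \<S>. beneath X tt {} I} \<union> insert n ` {t. t \<subseteq> X \<and> card t = 3 \<and> (\<forall>s\<in>tt. \<not> s \<subseteq> t)})"
    and "fvec (add_pt Q (w n)) = map2 (+) (fvec Q) [1, 4, 6 - card tt, 3 - card tt]"
proof -
  have cX: "card X = 4"
    using L unfolding labelled_polytope_def by simp
  then have fX: "finite X"
    using card.infinite by fastforce
  have sub_eq: "s \<subseteq> t \<longleftrightarrow> s = t" if "t \<subseteq> X" "card t = 3" "s \<in> tt" for s t
    using that tt(1)[of s] card_seteq[of t s] finite_subset[OF _ fX] by auto
  define D where "D = {Y. \<exists>I\<in>\<T>. beyond X {} I \<and> Y \<subseteq> I}"
  define N where "N = {Y \<in> D. plus_set \<T> (beneath X tt {}) Y}"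
  have D: "D = Pow X"
    using simplex_in_labels[OF L] labelled_superset_simplex[OF L]
    unfolding D_def beyond_def by blast
  \<comment> \<open>Smaller label sets extend to edges of the simplex, so the condition on edges
    saves the vertices and the empty face as well.\<close>
  have small: "plus_set \<T> (beneath X tt {}) Y" if Y: "Y \<subseteq> X" "card Y \<le> 2" for Y
  proof -
    have "\<exists>e. Y \<subseteq> e \<and> e \<subseteq> X \<and> card e = 2"
      using exists_subset_between[of Y 2 X] Y cX fX by auto
    then show ?thesis
      using edges unfolding plus_set_def by (meson subset_trans)
  qed
  have tri: "plus_set \<T> (beneath X tt {}) t \<longleftrightarrow> t \<notin> tt" if t: "t \<subseteq> X" "card t = 3" for t
  proof
    assume "plus_set \<T> (beneath X tt {}) t"
    then show "t \<notin> tt"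
      unfolding plus_set_def beneath_def by blast
  next
    assume nt: "t \<notin> tt"
    obtain I where I: "I \<in> \<T>" "\<not> X \<subseteq> I" "t \<subseteq> I"
      "\<And>s. s \<subseteq> X \<Longrightarrow> card s = 3 \<Longrightarrow> s \<subseteq> I \<Longrightarrow> s = t"
      using labelled_triangle_ex[OF L t] by blast
    then have "beneath X tt {} I"
      using tt(1) nt unfolding beneath_def by blast
    then show "plus_set \<T> (beneath X tt {}) t"
      using I unfolding plus_set_def by blast
  qed
  have top: "\<not> plus_set \<T> (beneath X tt {}) X"
    unfolding plus_set_def beneath_def by blast
  have "plus_set \<T> (beneath X tt {}) {}"
    by (rule small) auto
  then have ex: "\<exists>I\<in>\<T>. beneath X tt {} I"
    unfolding plus_set_def by blast
  have simplices: "I \<in> \<S>" if "I \<in> \<T>" "beyond X {} I" for I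
    using that labelled_superset_simplex[OF L] L(2) unfolding beyond_def by blast
  have N3: "{Y \<in> N. card Y = 3} = {t. t \<subseteq> X \<and> card t = 3 \<and> (\<forall>s\<in>tt. \<not> s \<subseteq> t)}"
    unfolding N_def D using tri sub_eq by auto
  have on: "{I \<in> \<T>. \<not> beneath X tt {} I \<and> \<not> beyond X {} I} = {I \<in> \<T>. \<not> X \<subseteq> I \<and> (\<exists>t\<in>tt. t \<subseteq> I)}"
    unfolding beneath_def beyond_def by auto
  have reg': "w n \<in> region Q (convex hull (w ` X))
      ((\<lambda>t. facet_across Q (convex hull (w ` X)) (w ` t)) ` tt)
      ((\<lambda>t. facet_across Q (convex hull (w ` X)) (w ` t)) ` {})"
    using reg by simp
  have emp: "\<And>t. t \<in> {} \<Longrightarrow> t \<subseteq> X \<and> card t = 3" "tt \<inter> {} = {}"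
    by auto
  note step = region_step[OF L tt(1) emp reg' ex simplices D_def N_def]
  show "labelled_polytope w (Suc n) (add_pt Q (w n))
      ({I \<in> \<T>. beneath X tt {} I} \<union> insert n ` {I \<in> \<T>. \<not> X \<subseteq> I \<and> (\<exists>t\<in>tt. t \<subseteq> I)} \<union>
        insert n ` {t. t \<subseteq> X \<and> card t = 3 \<and> (\<forall>s\<in>tt. \<not> s \<subseteq> t)})
      ({I \<in> \<S>. beneath X tt {} I} \<union> insert n ` {t. t \<subseteq> X \<and> card t = 3 \<and> (\<forall>s\<in>tt. \<not> s \<subseteq> t)})"
    using step(1) unfolding N3 on .
  have ttX: "tt \<subseteq> {Y. Y \<subseteq> X \<and> card Y = 3}"
    using tt(1) by blast
  have subsets: "card {Y. Y \<subseteq> X \<and> card Y = k} = 4 choose k" for k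
    using n_subsets[OF fX, of k] cX by simp
  have gain: "{Y \<in> N. card Y = k} = {Y. Y \<subseteq> X \<and> card Y = k}" if "k \<le> 2" for k
    unfolding N_def D using small that by auto
  have gain3: "{Y \<in> N. card Y = 3} = {Y. Y \<subseteq> X \<and> card Y = 3} - tt"
    unfolding N_def D using tri by auto
  have fin: "finite {Y. Y \<subseteq> X \<and> card Y = 3}"
    using fX by simp
  have c3: "card {Y \<in> N. card Y = 3} = 4 - card tt"
    unfolding gain3 using card_Diff_subset[OF finite_subset[OF ttX fin] ttX] subsets[of 3]
    by (simp add: numeral_eq_Suc)
  have lost: "{Y \<in> D - N. card Y = Suc k} = {}" if "k \<le> 1" for k
    unfolding N_def D using small that by auto
  have lost3: "{Y \<in> D - N. card Y = Suc 2} = tt"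
    unfolding N_def D using tri ttX by auto
  have lost4: "{Y \<in> D - N. card Y = Suc 3} = {X}"
    unfolding N_def D using top cX card_subset_eq[OF fX] by auto
  have small_k: "fvec (add_pt Q (w n)) ! k = fvec Q ! k + (4 choose k)" if k: "k \<le> 1" for k
  proof -
    have "k < 4" "k \<le> 2"
      using k by auto
    then show ?thesis
      using step(2)[of k] unfolding lost[OF k] gain[OF \<open>k \<le> 2\<close>] subsets by simp
  qed
  have "fvec (add_pt Q (w n)) ! 0 = fvec Q ! 0 + 1" "fvec (add_pt Q (w n)) ! 1 = fvec Q ! 1 + 4"
    using small_k[of 0] small_k[of 1] by simp_all
  moreover have "fvec (add_pt Q (w n)) ! 2 = fvec Q ! 2 + (6 - card tt)"
  proof -
    have "fvec (add_pt Q (w n)) ! 2 + card tt = fvec Q ! 2 + (4 choose 2)"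
      using step(2)[of 2] unfolding lost3 gain[OF order_refl] subsets by simp
    moreover have "(4 choose 2 :: nat) = 6"
      by (simp add: numeral_eq_Suc)
    ultimately show ?thesis
      using tt(2) by linarith
  qed
  moreover have "fvec (add_pt Q (w n)) ! 3 = fvec Q ! 3 + (3 - card tt)"
  proof -
    \<comment> \<open>The simplex itself is the only facet lost. The bound on \<open>card tt\<close>
      then makes the truncated difference \<open>3 - card tt\<close> exact.\<close>
    have "fvec (add_pt Q (w n)) ! 3 + card {X} = fvec Q ! 3 + (4 - card tt)"
      using step(2)[of 3] unfolding lost4 c3 by simp
    then show ?thesis
      using tt(2) by simp
  qed
  ultimately show "fvec (add_pt Q (w n)) = map2 (+) (fvec Q) [1, 4, 6 - card tt, 3 - card tt]"
    by (intro fvec_add_eqI) (auto simp: less_Suc_eq numeral_eq_Suc)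
qed

section \<open>The two constructions\<close>

lemma subsets_card_3:
  assumes "card {a, b, c, d} = 4"
  shows "{t. t \<subseteq> {a, b, c, d} \<and> card t = 3} = {{a, b, c}, {a, b, d}, {a, c, d}, {b, c, d}}" (is "?L = ?R")
proof
  let ?X = "{a, b, c, d}"
  have dist: "a \<noteq> b" "a \<noteq> c" "a \<noteq> d" "b \<noteq> c" "b \<noteq> d" "c \<noteq> d"
    using assms by (auto simp: card_insert_if split: if_splits)
  show "?L \<subseteq> ?R"
  proof
    fix t assume "t \<in> ?L"
    then have t: "t \<subseteq> ?X" "card t = 3"
      by auto
    then have "card (?X - t) = 1"
      using assms finite_subset[OF t(1)] by (subst card_Diff_subset) auto
    then obtain x where x: "?X - t = {x}"
      by (rule card_1_singletonE)
    then have "t = ?X - {x}" "x \<in> ?X"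
      using t(1) by auto
    then show "t \<in> ?R"
      using dist by auto
  qed
  show "?R \<subseteq> ?L"
    using dist by auto
qed

text \<open>The facets of the initial polytope that meet \<open>S\<close> in at most an edge never contain a triangle of a
  later simplex facet, so every new point is beneath them.\<close>

definition sparse :: "nat set set \<Rightarrow> bool" where
  "sparse R \<longleftrightarrow> (\<forall>I\<in>R. I \<subseteq> {0, 1, 2, 3} \<and> card I \<le> 2)"

lemma sparse_not_subset:
  assumes "sparse R" "I \<in> R" "3 \<le> card t"
  shows "\<not> t \<subseteq> I"
proof
  assume "t \<subseteq> I"
  have "finite I"
    using assms finite_subset[of I "{0, 1, 2, 3}"] unfolding sparse_def by auto
  then have "card t \<le> card I"
    using \<open>t \<subseteq> I\<close> card_mono by blast
  then show False
    using assms unfolding sparse_def by fastforce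
qed

lemma sparse_beneath:
  assumes "sparse R" "card X = 4" "\<And>t. t \<in> tt \<union> nn \<Longrightarrow> card t = 3" "I \<in> R"
  shows "beneath X tt nn I"
  using sparse_not_subset[OF assms(1,4)] assms(2,3) unfolding beneath_def by simp

text \<open>A named selection, which the two rules below evaluate on an explicitly listed family one
  element at a time.\<close>

definition sieve :: "('a \<Rightarrow> bool) \<Rightarrow> 'a set \<Rightarrow> 'a set" where
  "sieve P A = {x \<in> A. P x}"

lemma sieve_simps [simp]:
  "sieve P {} = {}"
  "sieve P (insert a A) = (if P a then insert a (sieve P A) else sieve P A)"
  by (auto simp: sieve_def)

text \<open>The label family is split into an explicit part \<open>A\<close>, to which all case
  checks are confined, and the sparse rest \<open>R\<close>. \<open>\<S>'\<close> may be any part of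
  the resulting simplices, so that only those needed later are carried on.\<close>

lemma sparse_step:
  assumes L: "labelled_polytope w n Q (A \<union> R) \<S>" "{a, b, c, d} \<in> \<S>" and R: "sparse R"
    and tt: "tt \<subseteq> {{a, b, c}, {a, b, d}, {a, c, d}, {b, c, d}}" "card tt = m" "m \<le> 3"
    and reg: "w n \<in> region Q (convex hull (w ` {a, b, c, d}))
      ((\<lambda>t. facet_across Q (convex hull (w ` {a, b, c, d})) (w ` t)) ` tt) {}"
    and edges: "\<forall>e\<in>{{a, b}, {a, c}, {a, d}, {b, c}, {b, d}, {c, d}}. \<exists>I\<in>A. e \<subseteq> I \<and> beneath {a, b, c, d} tt {} I"
    and \<S>': "\<S>' \<subseteq> sieve (beneath {a, b, c, d} tt {}) \<S> \<union>
      insert n ` sieve (\<lambda>t. \<forall>s\<in>tt. \<not> s \<subseteq> t) {{a, b, c}, {a, b, d}, {a, c, d}, {b, c, d}}"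
  shows "labelled_polytope w (Suc n) (add_pt Q (w n))
      ((sieve (beneath {a, b, c, d} tt {}) A \<union>
        insert n ` sieve (\<lambda>I. \<not> {a, b, c, d} \<subseteq> I \<and> (\<exists>t\<in>tt. t \<subseteq> I)) A \<union>
        insert n ` sieve (\<lambda>t. \<forall>s\<in>tt. \<not> s \<subseteq> t) {{a, b, c}, {a, b, d}, {a, c, d}, {b, c, d}}) \<union> R) \<S>'"
    and "fvec (add_pt Q (w n)) = map2 (+) (fvec Q) [1, 4, 6 - m, 3 - m]"
proof -
  let ?X = "{a, b, c, d}"
  have cX: "card ?X = 4"
    using L unfolding labelled_polytope_def by blast
  note tri = subsets_card_3[OF cX]
  have tt': "t \<subseteq> ?X \<and> card t = 3" if "t \<in> tt" for t
    using that tt(1) tri by blast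
  have edges': "\<exists>I\<in>A \<union> R. e \<subseteq> I \<and> beneath ?X tt {} I" if e: "e \<subseteq> ?X" "card e = 2" for e
  proof -
    obtain x y where "e = {x, y}" "x \<noteq> y"
      using e(2) by (auto simp: card_2_iff)
    then have "e \<in> {{a, b}, {a, c}, {a, d}, {b, c}, {b, d}, {c, d}}"
      using e(1) by auto
    then show ?thesis
      using edges by blast
  qed
  have RI: "beneath ?X tt {} I" if "I \<in> R" for I
    using sparse_beneath[OF R cX _ that, of tt "{}"] tt' by simp
  have 1: "{I \<in> A \<union> R. beneath ?X tt {} I} = sieve (beneath ?X tt {}) A \<union> R"
    using RI unfolding sieve_def by blast
  have 2: "{I \<in> A \<union> R. \<not> ?X \<subseteq> I \<and> (\<exists>t\<in>tt. t \<subseteq> I)} = sieve (\<lambda>I. \<not> ?X \<subseteq> I \<and> (\<exists>t\<in>tt. t \<subseteq> I)) A"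
    using RI unfolding beneath_def sieve_def by blast
  have 3: "{t. t \<subseteq> ?X \<and> card t = 3 \<and> (\<forall>s\<in>tt. \<not> s \<subseteq> t)} =
      sieve (\<lambda>t. \<forall>s\<in>tt. \<not> s \<subseteq> t) {{a, b, c}, {a, b, d}, {a, c, d}, {b, c, d}}"
    unfolding tri[symmetric] sieve_def by blast
  have "card tt \<le> 3"
    using tt(2,3) by simp
  note step = single_step[OF L tt' this reg edges', unfolded 1 2 3, folded sieve_def]
  have eq: "M \<union> R \<union> N \<union> N' = (M \<union> N \<union> N') \<union> R" for M N N' :: "nat set set"
    by blast
  show "labelled_polytope w (Suc n) (add_pt Q (w n))
      ((sieve (beneath ?X tt {}) A \<union>
        insert n ` sieve (\<lambda>I. \<not> ?X \<subseteq> I \<and> (\<exists>t\<in>tt. t \<subseteq> I)) A \<union>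
        insert n ` sieve (\<lambda>t. \<forall>s\<in>tt. \<not> s \<subseteq> t) {{a, b, c}, {a, b, d}, {a, c, d}, {b, c, d}}) \<union> R) \<S>'"
    using labelled_polytope_mono[OF step(1) \<S>'] unfolding eq .
  show "fvec (add_pt Q (w n)) = map2 (+) (fvec Q) [1, 4, 6 - m, 3 - m]"
    using step(2) unfolding tt(2) .
qed

text \<open>The neighbour across a triangle contains exactly three of the vertices, since only the
  simplex contains all four. So all four triangles are label sets, and every other label set except
  that of the simplex has at most two elements.\<close>

lemma labelled_polytope_initial:
  assumes "polytope P" "aff_dim P = 4" "card {w 0, w 1, w 2, w 3} = 4"
    "\<not> affine_dependent {w 0, w 1, w 2, w 3}" "convex hull {w 0, w 1, w 2, w 3} facet_of P"
  obtains R where "sparse R"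
    "labelled_polytope w 4 P ({{0, 1, 2, 3}, {0, 1, 2}, {0, 1, 3}, {0, 2, 3}, {1, 2, 3}} \<union> R) {{0, 1, 2, 3}}"
proof -
  define X where "X = {0::nat, 1, 2, 3}"
  have wX: "w ` X = {w 0, w 1, w 2, w 3}"
    by (auto simp: X_def)
  have X4: "X = {..<4}"
    by (auto simp: X_def)
  have cX: "card X = 4"
    by (simp add: X_def)
  have inj: "inj_on w X"
    using assms(3) cX unfolding wX[symmetric] by (intro eq_card_imp_inj_on) (auto simp: X_def)
  define \<T> where "\<T> = labels w 4 ` {F. F facet_of P}"
  interpret s: simplex_facet P "w ` X"
    using assms unfolding wX by unfold_locales
  have "w ` X \<subseteq> P"
    using s.facet facet_of_imp_subset hull_subset[of "w ` X" convex] by blast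
  moreover have "labels w 4 (convex hull (w ` X)) = X"
    using hull_subset[of "w ` X" convex] by (auto simp: labels_def X4)
  ultimately have L: "labelled_polytope w 4 P \<T> {X}"
    using s.polytope s.full_dim s.indep s.facet inj cX
    unfolding labelled_polytope_def \<T>_def by (simp add: X4)
  have sub: "I \<subseteq> X" if "I \<in> \<T>" for I
    using that by (auto simp: \<T>_def labels_def X4)
  have finX: "finite X"
    by (simp add: X4)
  define R where "R = {I \<in> \<T>. card I \<le> 2}"
  have 3: "t \<in> \<T>" if t: "t \<subseteq> X" "card t = 3" for t
  proof -
    obtain I where I: "I \<in> \<T>" "\<not> X \<subseteq> I" "t \<subseteq> I"
      "\<And>s. s \<subseteq> X \<Longrightarrow> card s = 3 \<Longrightarrow> s \<subseteq> I \<Longrightarrow> s = t"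
      using labelled_triangle_ex[OF L singletonI t] by blast
    have "card I < 4"
      using psubset_card_mono[OF finX, of I] sub[OF I(1)] I(2) cX by auto
    then have "I = t"
      using card_seteq[of I t] I(3) t(2) finite_subset[OF sub[OF I(1)] finX] by simp
    then show ?thesis
      using I by simp
  qed
  have "\<T> = {X} \<union> {t. t \<subseteq> X \<and> card t = 3} \<union> R"
  proof
    show "\<T> \<subseteq> {X} \<union> {t. t \<subseteq> X \<and> card t = 3} \<union> R"
    proof
      fix I assume I: "I \<in> \<T>"
      then have "card I \<le> 4"
        using card_mono[OF finX sub[OF I]] cX by simp
      then consider "card I = 4" | "card I = 3" | "card I \<le> 2"
        by linarith
      then show "I \<in> {X} \<union> {t. t \<subseteq> X \<and> card t = 3} \<union> R"
      proof cases
        case 1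
        then have "I = X"
          using card_subset_eq[OF finX sub[OF I]] cX by simp
        then show ?thesis
          by blast
      next
        case 2
        then show ?thesis
          using sub[OF I] by blast
      next
        case 3
        then show ?thesis
          using I unfolding R_def by blast
      qed
    qed
    show "{X} \<union> {t. t \<subseteq> X \<and> card t = 3} \<union> R \<subseteq> \<T>"
      using 3 simplex_in_labels[OF L singletonI] unfolding R_def by blast
  qed
  also have "\<dots> = {{0, 1, 2, 3}, {0, 1, 2}, {0, 1, 3}, {0, 2, 3}, {1, 2, 3}} \<union> R"
    unfolding X_def subsets_card_3[OF cX[unfolded X_def]] by (simp add: insert_commute)
  finally have "\<T> = {{0, 1, 2, 3}, {0, 1, 2}, {0, 1, 3}, {0, 2, 3}, {1, 2, 3}} \<union> R" .
  moreover have "sparse R"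
    unfolding sparse_def using sub unfolding R_def X_def by blast
  ultimately show ?thesis
    using that L unfolding X_def by simp
qed

text \<open>The only step beyond two facets, \<open>0234\<close> and \<open>2345\<close>. It is also the only one that loses an edge:
  all facets through \<open>24\<close> are these two and \<open>01245\<close>, whose hyperplane contains the new point.\<close>

lemma I2_third_step:
  assumes L: "labelled_polytope w 6 Q
      ({{1, 3, 4, 5}, {2, 3, 4, 5}, {0, 1, 2, 4, 5}, {1, 2, 3, 5}, {0, 2, 3, 4}, {0, 1, 3, 4}, {0, 1, 2}, {0, 2, 3}} \<union> R)
      {{0, 2, 3, 4}, {2, 3, 4, 5}}" and R: "sparse R"
    and reg: "w 6 \<in> region Q (convex hull (w ` {0, 2, 3, 4}))
      ((\<lambda>t. facet_across Q (convex hull (w ` {0, 2, 3, 4})) (w ` t)) ` {{0, 2, 4}, {0, 2, 3}})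
      ((\<lambda>t. facet_across Q (convex hull (w ` {0, 2, 3, 4})) (w ` t)) ` {{2, 3, 4}})"
  shows "labelled_polytope w 7 (add_pt Q (w 6))
      ({{0, 3, 4, 6}, {2, 3, 5, 6}, {3, 4, 5, 6}, {0, 1, 2, 4, 5, 6}, {0, 2, 3, 6}, {1, 3, 4, 5}, {1, 2, 3, 5}, {0, 1, 3, 4}, {0, 1, 2}} \<union> R)
      {{3, 4, 5, 6}}"
    and "fvec (add_pt Q (w 6)) = map2 (+) (fvec Q) [1, 4, 4, 1]"
proof -
  define A :: "nat set set" where
    "A = {{1, 3, 4, 5}, {2, 3, 4, 5}, {0, 1, 2, 4, 5}, {1, 2, 3, 5}, {0, 2, 3, 4}, {0, 1, 3, 4}, {0, 1, 2}, {0, 2, 3}}"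
  define X :: "nat set" where "X = {0, 2, 3, 4}"
  define X' :: "nat set" where "X' = {2, 3, 4, 5}"
  define tt :: "nat set set" where "tt = {{0, 2, 4}, {0, 2, 3}}"
  define nn :: "nat set set" where "nn = {{2, 3, 4}}"
  note defs = A_def X_def X'_def tt_def nn_def
  \<comment> \<open>The faces of the two simplices that lie in no facet beneath: one edge, four
    triangles and the simplices themselves.\<close>
  define lost :: "nat set set" where
    "lost = {{2, 4}, {2, 3, 4}, {0, 2, 4}, {0, 2, 3}, {2, 4, 5}, X, X'}"
  define D where "D = {Y. \<exists>I\<in>A \<union> R. beyond X nn I \<and> Y \<subseteq> I}"
  define N where "N = {Y \<in> D. plus_set (A \<union> R) (beneath X tt nn) Y}"
  have tt: "t \<subseteq> X \<and> card t = 3" if "t \<in> tt" for t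
    using that by (auto simp: defs)
  have nn: "t \<subseteq> X \<and> card t = 3" if "t \<in> nn" for t
    using that by (auto simp: defs)
  have cX: "card X = 4" "card X' = 4" "card (X \<inter> X') = 3"
    by (simp_all add: defs)
  have fin: "finite X" "finite X'"
    by (simp_all add: defs)
  have disj: "tt \<inter> nn = {}"
    by (simp add: defs set_eq_subset)
  have RI: "beneath X tt nn I" if "I \<in> R" for I
    using sparse_beneath[OF R cX(1) _ that] tt nn by blast
  have R_beyond: "\<not> beyond X nn I" if "I \<in> R" for I
    using RI[OF that] unfolding beneath_def beyond_def by blast
  have "\<forall>I\<in>A. beyond X nn I \<longleftrightarrow> I = X \<or> I = X'"
    by (simp add: beyond_def defs set_eq_subset)
  then have A_beyond: "beyond X nn I \<longleftrightarrow> I = X \<or> I = X'" if "I \<in> A" for I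
    using that by blast
  have XA: "X \<in> A" "X' \<in> A"
    by (simp_all add: defs)
  have D: "D = Pow X \<union> Pow X'"
    unfolding D_def using R_beyond A_beyond XA by blast
  have kept: "sieve (beneath X tt nn) A = {{1, 3, 4, 5}, {1, 2, 3, 5}, {0, 1, 3, 4}, {0, 1, 2}}"
    by (simp add: defs beneath_def)
  have on: "sieve (\<lambda>I. \<not> beneath X tt nn I \<and> \<not> beyond X nn I) A = {{0, 1, 2, 4, 5}, {0, 2, 3}}"
    by (simp add: defs beneath_def beyond_def)
  \<comment> \<open>The four sets are the maximal intersections of the label sets in
    \<open>kept\<close> with the two simplices.\<close>
  have plus: "plus_set (A \<union> R) (beneath X tt nn) Y"
    if "Y \<subseteq> {0, 3, 4} \<or> Y \<subseteq> {2, 3, 5} \<or> Y \<subseteq> {3, 4, 5} \<or> Y \<subseteq> {0, 2}" for Y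
  proof -
    have "\<exists>I\<in>sieve (beneath X tt nn) A. Y \<subseteq> I"
      unfolding kept using that by auto
    then show ?thesis
      unfolding plus_set_def sieve_def by blast
  qed
  have not_plus: "\<not> plus_set (A \<union> R) (beneath X tt nn) Y" if Y: "Y \<in> lost" for Y
  proof
    assume "plus_set (A \<union> R) (beneath X tt nn) Y"
    then obtain I where I: "I \<in> sieve (beneath X tt nn) A \<or> I \<in> R" "Y \<subseteq> I"
      unfolding plus_set_def sieve_def by blast
    from I(1) show False
    proof
      assume "I \<in> sieve (beneath X tt nn) A"
      moreover have "\<forall>Y\<in>lost. \<forall>I\<in>sieve (beneath X tt nn) A. \<not> Y \<subseteq> I"
        unfolding kept lost_def by (simp add: defs)
      ultimately show False
        using Y I(2) by blast
    next
      \<comment> \<open>Label sets in \<open>R\<close> lack 4 and have at most two elements, whereas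
        each lost set contains 4 or includes 023.\<close>
      assume IR: "I \<in> R"
      then have "4 \<notin> I"
        using R unfolding sparse_def by force
      moreover have "\<not> {0, 2, 3} \<subseteq> I"
        using sparse_not_subset[OF R IR, of "{0, 2, 3}"] by simp
      moreover have "\<forall>Y\<in>lost. 4 \<in> Y \<or> {0, 2, 3} \<subseteq> Y"
        unfolding lost_def by (simp add: defs)
      ultimately show False
        using Y I(2) by blast
    qed
  qed
  have cover: "Y \<in> lost \<or> Y \<subseteq> {0, 3, 4} \<or> Y \<subseteq> {2, 3, 5} \<or> Y \<subseteq> {3, 4, 5} \<or> Y \<subseteq> {0, 2}" if "Y \<in> D" for Y
  proof -
    have "\<forall>Y\<in>Pow {0, 2, 3, 4} \<union> Pow {2, 3, 4, 5 :: nat}. Y \<in> lost \<or>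
        Y \<subseteq> {0, 3, 4} \<or> Y \<subseteq> {2, 3, 5} \<or> Y \<subseteq> {3, 4, 5} \<or> Y \<subseteq> {0, 2}"
      unfolding lost_def X_def X'_def by (simp add: Pow_insert ball_Un insert_commute)
    moreover have "Y \<in> Pow {0, 2, 3, 4} \<union> Pow {2, 3, 4, 5}"
      using that unfolding D X_def X'_def .
    ultimately show ?thesis
      by (rule bspec)
  qed
  have "plus_set (A \<union> R) (beneath X tt nn) Y \<longleftrightarrow> Y \<notin> lost" if "Y \<in> D" for Y
    using plus[of Y] not_plus[of Y] cover[OF that] by argo
  then have N: "N = D - lost"
    unfolding N_def by blast
  have lost_D: "lost \<subseteq> D"
    unfolding D lost_def by (auto simp: defs)
  have N3: "{Y \<in> N. card Y = 3} = {{0, 3, 4}, {2, 3, 5}, {3, 4, 5}}"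
  proof
    show "{Y \<in> N. card Y = 3} \<subseteq> {{0, 3, 4}, {2, 3, 5}, {3, 4, 5}}"
    proof
      fix Y assume "Y \<in> {Y \<in> N. card Y = 3}"
      then have Y: "Y \<in> D" "Y \<notin> lost" "card Y = 3"
        unfolding N by auto
      have eq: "Y = Z" if "Y \<subseteq> Z" "finite Z" "card Z = 3" for Z
        using card_subset_eq[of Z Y] that Y(3) by simp
      have "\<not> Y \<subseteq> {0, 2}"
        using card_mono[of "{0, 2}" Y] Y(3) by auto
      then show "Y \<in> {{0, 3, 4}, {2, 3, 5}, {3, 4, 5}}"
        using cover[OF Y(1)] Y(2) eq[of "{0, 3, 4}"] eq[of "{2, 3, 5}"] eq[of "{3, 4, 5}"] by auto
    qed
    show "{{0, 3, 4}, {2, 3, 5}, {3, 4, 5}} \<subseteq> {Y \<in> N. card Y = 3}"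
      unfolding N D lost_def by (simp add: defs set_eq_subset)
  qed
  have L': "labelled_polytope w 6 Q (A \<union> R) {X, X'}" and reg': "w 6 \<in> region Q (convex hull (w ` X))
      ((\<lambda>t. facet_across Q (convex hull (w ` X)) (w ` t)) ` tt)
      ((\<lambda>t. facet_across Q (convex hull (w ` X)) (w ` t)) ` nn)"
    using L reg unfolding defs .
  have XS: "X \<in> {X, X'}"
    by simp
  have ex: "\<exists>I\<in>A \<union> R. beneath X tt nn I"
    using plus[of "{}"] unfolding plus_set_def by blast
  have simplices: "I \<in> {X, X'}" if "I \<in> A \<union> R" "beyond X nn I" for I
    using that A_beyond R_beyond by blast
  note step = region_step[OF L' XS tt nn disj reg' ex simplices D_def N_def]
  have 1: "{I \<in> A \<union> R. beneath X tt nn I} = sieve (beneath X tt nn) A \<union> R"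
    using RI unfolding sieve_def by blast
  have 2: "{I \<in> A \<union> R. \<not> beneath X tt nn I \<and> \<not> beyond X nn I} =
      sieve (\<lambda>I. \<not> beneath X tt nn I \<and> \<not> beyond X nn I) A"
    using RI unfolding sieve_def by blast
  have new: "{{3, 4, 5, 6}} \<subseteq> {I \<in> {X, X'}. beneath X tt nn I} \<union> insert 6 ` {{0, 3, 4}, {2, 3, 5}, {3, 4, 5}}"
    by (simp add: insert_commute)
  show "labelled_polytope w 7 (add_pt Q (w 6))
      ({{0, 3, 4, 6}, {2, 3, 5, 6}, {3, 4, 5, 6}, {0, 1, 2, 4, 5, 6}, {0, 2, 3, 6}, {1, 3, 4, 5}, {1, 2, 3, 5}, {0, 1, 3, 4}, {0, 1, 2}} \<union> R)
      {{3, 4, 5, 6}}"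
    using labelled_polytope_mono[OF step(1)[unfolded 1 2 kept on N3] new] by (simp add: insert_commute)
  have finD: "finite D"
    unfolding D using fin by simp
  \<comment> \<open>Inclusion and exclusion for two tetrahedra with the common triangle 234.\<close>
  have subsets: "card {Y \<in> D. card Y = k} + (3 choose k) = 2 * (4 choose k)" for k
  proof -
    let ?S = "\<lambda>Z. {Y. Y \<subseteq> Z \<and> card Y = k}"
    have "card (?S X \<union> ?S X') + card (?S X \<inter> ?S X') = card (?S X) + card (?S X')"
      using fin by (intro card_Un_Int[symmetric]) auto
    moreover have "?S X \<inter> ?S X' = ?S (X \<inter> X')" "{Y \<in> D. card Y = k} = ?S X \<union> ?S X'"
      unfolding D by auto
    ultimately show ?thesis
      using n_subsets[OF fin(1), of k] n_subsets[OF fin(2), of k] n_subsets[of "X \<inter> X'" k] fin cX by simp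
  qed
  have gain: "card {Y \<in> N. card Y = k} + card (sieve (\<lambda>Y. card Y = k) lost) = card {Y \<in> D. card Y = k}" for k
  proof -
    have "{Y \<in> D. card Y = k} = {Y \<in> N. card Y = k} \<union> sieve (\<lambda>Y. card Y = k) lost"
      "{Y \<in> N. card Y = k} \<inter> sieve (\<lambda>Y. card Y = k) lost = {}"
      using lost_D unfolding N sieve_def by auto
    moreover have "finite {Y \<in> N. card Y = k}" "finite (sieve (\<lambda>Y. card Y = k) lost)"
      using finD finite_subset[OF lost_D] unfolding N sieve_def by auto
    ultimately show ?thesis
      by (simp add: card_Un_disjoint)
  qed
  have lost_eq: "{Y \<in> D - N. card Y = Suc k} = sieve (\<lambda>Y. card Y = Suc k) lost" for k
    using lost_D unfolding N sieve_def by auto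
  have count: "card (sieve (\<lambda>Y. card Y = 0) lost) = 0" "card (sieve (\<lambda>Y. card Y = 1) lost) = 0"
    "card (sieve (\<lambda>Y. card Y = 2) lost) = 1" "card (sieve (\<lambda>Y. card Y = 3) lost) = 4"
    "card (sieve (\<lambda>Y. card Y = 4) lost) = 2"
    unfolding lost_def by (simp_all add: defs set_eq_subset)
  have choose: "(3 choose 0 :: nat) = 1" "(3 choose 1 :: nat) = 3" "(3 choose 2 :: nat) = 3" "(3 choose 3 :: nat) = 1"
    "(4 choose 0 :: nat) = 1" "(4 choose 1 :: nat) = 4" "(4 choose 2 :: nat) = 6" "(4 choose 3 :: nat) = 4"
    by (simp_all add: numeral_eq_Suc)
  \<comment> \<open>The complex has 5 vertices, 9 edges, 7 triangles and 2 tetrahedra. Its surviving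
    faces, with the empty one, are coned to 1 vertex, 5 edges, 8 triangles and 3 facets; the losses
    are 1 edge, 4 triangles and 2 facets.\<close>
  note f = step(2)[unfolded lost_eq]
  have "fvec (add_pt Q (w 6)) ! 0 = fvec Q ! 0 + 1"
    using f[of 0] gain[of 0] subsets[of 0] count choose by simp
  moreover have "fvec (add_pt Q (w 6)) ! 1 = fvec Q ! 1 + 4"
    using f[of 1] gain[of 1] subsets[of 1] count choose by (simp add: numeral_2_eq_2)
  moreover have "fvec (add_pt Q (w 6)) ! 2 = fvec Q ! 2 + 4"
    using f[of 2] gain[of 2] subsets[of 2] count choose by simp
  moreover have "fvec (add_pt Q (w 6)) ! 3 = fvec Q ! 3 + 1"
    using f[of 3] gain[of 3] subsets[of 3] count choose by simp
  ultimately show "fvec (add_pt Q (w 6)) = map2 (+) (fvec Q) [1, 4, 4, 1]"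
    by (intro fvec_add_eqI) (auto simp: less_Suc_eq numeral_eq_Suc)
qed

text \<open>The five points lie on 1, 2, 2, 2 and 3 neighbouring hyperplanes, which gives the
  increments (1,4,5,2), three times (1,4,4,1), and (1,4,3,0).\<close>

lemma fvec_I1_result:
  assumes P: "polytope P" "aff_dim P = 4" "card {v0, v1, v2, v3} = 4"
    "\<not> affine_dependent {v0, v1, v2, v3}" "convex hull {v0, v1, v2, v3} facet_of P"
    and choice: "I1_choice P v0 v1 v2 v3 v4 v5 v6 v7 v8"
  shows "fvec (I1_result P v4 v5 v6 v7 v8) = map2 (+) (fvec P) [5, 20, 20, 5]"
proof -
  define w where "w = (!) [v0, v1, v2, v3, v4, v5, v6, v7, v8]"
  have w: "w 0 = v0" "w 1 = v1" "w (Suc 0) = v1" "w 2 = v2" "w 3 = v3" "w 4 = v4" "w 5 = v5" "w 6 = v6" "w 7 = v7" "w 8 = v8"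
    by (simp_all add: w_def)
  define P0 where "P0 = P"
  define P1 where "P1 = add_pt P0 (w 4)"
  define P2 where "P2 = add_pt P1 (w 5)"
  define P3 where "P3 = add_pt P2 (w 6)"
  define P4 where "P4 = add_pt P3 (w 7)"
  define P5 where "P5 = add_pt P4 (w 8)"
  note defs = P0_def P1_def P2_def P3_def P4_def
  obtain R where R: "sparse R"
    and L0: "labelled_polytope w 4 P0 ({{0, 1, 2, 3}, {0, 1, 2}, {0, 1, 3}, {0, 2, 3}, {1, 2, 3}} \<union> R) {{0, 1, 2, 3}}"
    using labelled_polytope_initial[of P w] P unfolding w P0_def by blast
  have reg1: "w 4 \<in> region P0 (convex hull (w ` {0, 1, 2, 3}))
      ((\<lambda>t. facet_across P0 (convex hull (w ` {0, 1, 2, 3})) (w ` t)) ` {{0, 1, 2}}) {}"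
    using choice unfolding I1_choice_def Let_def defs by (simp add: w)
  have reg2: "w 5 \<in> region P1 (convex hull (w ` {0, 1, 3, 4}))
      ((\<lambda>t. facet_across P1 (convex hull (w ` {0, 1, 3, 4})) (w ` t)) ` {{1, 3, 4}, {0, 1, 3}}) {}"
    using choice unfolding I1_choice_def Let_def defs by (simp add: w)
  have reg3: "w 6 \<in> region P2 (convex hull (w ` {0, 2, 3, 4}))
      ((\<lambda>t. facet_across P2 (convex hull (w ` {0, 2, 3, 4})) (w ` t)) ` {{0, 3, 4}, {0, 2, 3}}) {}"
    using choice unfolding I1_choice_def Let_def defs by (simp add: w)
  have reg4: "w 7 \<in> region P3 (convex hull (w ` {2, 3, 4, 6}))
      ((\<lambda>t. facet_across P3 (convex hull (w ` {2, 3, 4, 6})) (w ` t)) ` {{2, 3, 4}, {2, 3, 6}}) {}"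
    using choice unfolding I1_choice_def Let_def defs by (simp add: w)
  have reg5: "w 8 \<in> region P4 (convex hull (w ` {0, 2, 4, 6}))
      ((\<lambda>t. facet_across P4 (convex hull (w ` {0, 2, 4, 6})) (w ` t)) ` {{0, 4, 6}, {2, 4, 6}, {0, 2, 4}}) {}"
    using choice unfolding I1_choice_def Let_def defs by (simp add: w)
  have c1: "card {{0, 1, 2 :: nat}} = 1"
    by (simp add: set_eq_subset)
  \<comment> \<open>The instantiated family lists the new simplices over which later points are
    placed.\<close>
  note step1 = sparse_step[OF L0 _ R _ c1 _ reg1, of "{{0, 1, 3, 4}, {0, 2, 3, 4}}"]
  have L1: "labelled_polytope w 5 P1 ({{0, 1, 3, 4}, {0, 2, 3, 4}, {1, 2, 3, 4}, {0, 1, 2, 4}, {0, 1, 3}, {0, 2, 3}, {1, 2, 3}} \<union> R) {{0, 1, 3, 4}, {0, 2, 3, 4}}"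
    using step1(1) unfolding P1_def by (simp add: beneath_def insert_commute)
  have f1: "fvec P1 = map2 (+) (fvec P0) [1, 4, 5, 2]"
    using step1(2) unfolding P1_def by (simp add: beneath_def insert_commute)
  have c2: "card {{1, 3, 4}, {0, 1, 3 :: nat}} = 2"
    by (simp add: set_eq_subset)
  note step2 = sparse_step[OF L1 _ R _ c2 _ reg2, of "{{0, 2, 3, 4}}"]
  have L2: "labelled_polytope w 6 P2 ({{0, 1, 4, 5}, {0, 3, 4, 5}, {1, 2, 3, 4, 5}, {0, 1, 3, 5}, {0, 2, 3, 4}, {0, 1, 2, 4}, {0, 2, 3}, {1, 2, 3}} \<union> R) {{0, 2, 3, 4}}"
    using step2(1) unfolding P2_def by (simp add: beneath_def insert_commute)
  have f2: "fvec P2 = map2 (+) (fvec P1) [1, 4, 4, 1]"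
    using step2(2) unfolding P2_def by (simp add: beneath_def insert_commute)
  have c3: "card {{0, 3, 4}, {0, 2, 3 :: nat}} = 2"
    by (simp add: set_eq_subset)
  note step3 = sparse_step[OF L2 _ R _ c3 _ reg3, of "{{2, 3, 4, 6}, {0, 2, 4, 6}}"]
  have L3: "labelled_polytope w 7 P3 ({{0, 2, 4, 6}, {2, 3, 4, 6}, {0, 3, 4, 5, 6}, {0, 2, 3, 6}, {0, 1, 4, 5}, {1, 2, 3, 4, 5}, {0, 1, 3, 5}, {0, 1, 2, 4}, {1, 2, 3}} \<union> R) {{2, 3, 4, 6}, {0, 2, 4, 6}}"
    using step3(1) unfolding P3_def by (simp add: beneath_def insert_commute)
  have f3: "fvec P3 = map2 (+) (fvec P2) [1, 4, 4, 1]"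
    using step3(2) unfolding P3_def by (simp add: beneath_def insert_commute)
  have c4: "card {{2, 3, 4}, {2, 3, 6 :: nat}} = 2"
    by (simp add: set_eq_subset)
  note step4 = sparse_step[OF L3 _ R _ c4 _ reg4, of "{{0, 2, 4, 6}}"]
  have L4: "labelled_polytope w 8 P4 ({{2, 4, 6, 7}, {3, 4, 6, 7}, {0, 2, 3, 6, 7}, {1, 2, 3, 4, 5, 7}, {0, 2, 4, 6}, {0, 3, 4, 5, 6}, {0, 1, 4, 5}, {0, 1, 3, 5}, {0, 1, 2, 4}, {1, 2, 3}} \<union> R) {{0, 2, 4, 6}}"
    using step4(1) unfolding P4_def by (simp add: beneath_def insert_commute)
  have f4: "fvec P4 = map2 (+) (fvec P3) [1, 4, 4, 1]"
    using step4(2) unfolding P4_def by (simp add: beneath_def insert_commute)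
  have c5: "card {{0, 4, 6}, {2, 4, 6}, {0, 2, 4 :: nat}} = 3"
    by (simp add: set_eq_subset)
  note step5 = sparse_step[OF L4 _ R _ c5 _ reg5, of "{}"]
  have f5: "fvec P5 = map2 (+) (fvec P4) [1, 4, 3, 0]"
    using step5(2) unfolding P5_def by (simp add: beneath_def insert_commute)
  have "I1_result P v4 v5 v6 v7 v8 = P5"
    unfolding I1_result_def P5_def defs w ..
  moreover have "fvec P5 = map2 (+) (fvec P0) [5, 20, 20, 5]"
    unfolding f5 f4 f3 f2 f1 by (simp add: fvec_def)
  ultimately show ?thesis
    unfolding P0_def by simp
qed

text \<open>The first, second and last point lie on 1, 2 and 3 neighbouring hyperplanes. With the
  exceptional third step, the increments are (1,4,5,2), twice (1,4,4,1), and (1,4,3,0).\<close>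

lemma fvec_I2_result:
  assumes P: "polytope P" "aff_dim P = 4" "card {v0, v1, v2, v3} = 4"
    "\<not> affine_dependent {v0, v1, v2, v3}" "convex hull {v0, v1, v2, v3} facet_of P"
    and choice: "I2_choice P v0 v1 v2 v3 v4 v5 v6 v7"
  shows "fvec (I2_result P v4 v5 v6 v7) = map2 (+) (fvec P) [4, 16, 16, 4]"
proof -
  define w where "w = (!) [v0, v1, v2, v3, v4, v5, v6, v7]"
  have w: "w 0 = v0" "w 1 = v1" "w (Suc 0) = v1" "w 2 = v2" "w 3 = v3" "w 4 = v4" "w 5 = v5" "w 6 = v6" "w 7 = v7"
    by (simp_all add: w_def)
  define P0 where "P0 = P"
  define P1 where "P1 = add_pt P0 (w 4)"
  define P2 where "P2 = add_pt P1 (w 5)"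
  define P3 where "P3 = add_pt P2 (w 6)"
  define P4 where "P4 = add_pt P3 (w 7)"
  note defs = P0_def P1_def P2_def P3_def
  obtain R where R: "sparse R"
    and L0: "labelled_polytope w 4 P0 ({{0, 1, 2, 3}, {0, 1, 2}, {0, 1, 3}, {0, 2, 3}, {1, 2, 3}} \<union> R) {{0, 1, 2, 3}}"
    using labelled_polytope_initial[of P w] P unfolding w P0_def by blast
  have reg1: "w 4 \<in> region P0 (convex hull (w ` {0, 1, 2, 3}))
      ((\<lambda>t. facet_across P0 (convex hull (w ` {0, 1, 2, 3})) (w ` t)) ` {{0, 1, 3}}) {}"
    using choice unfolding I2_choice_def Let_def defs by (simp add: w)
  have reg2: "w 5 \<in> region P1 (convex hull (w ` {1, 2, 3, 4}))
      ((\<lambda>t. facet_across P1 (convex hull (w ` {1, 2, 3, 4})) (w ` t)) ` {{1, 2, 4}, {1, 2, 3}}) {}"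
    using choice unfolding I2_choice_def Let_def defs by (simp add: w)
  have reg3: "w 6 \<in> region P2 (convex hull (w ` {0, 2, 3, 4}))
      ((\<lambda>t. facet_across P2 (convex hull (w ` {0, 2, 3, 4})) (w ` t)) ` {{0, 2, 4}, {0, 2, 3}}) ((\<lambda>t. facet_across P2 (convex hull (w ` {0, 2, 3, 4})) (w ` t)) ` {{2, 3, 4}})"
    using choice unfolding I2_choice_def Let_def defs by (simp add: w)
  have reg4: "w 7 \<in> region P3 (convex hull (w ` {3, 4, 5, 6}))
      ((\<lambda>t. facet_across P3 (convex hull (w ` {3, 4, 5, 6})) (w ` t)) ` {{3, 4, 6}, {3, 4, 5}, {3, 5, 6}}) {}"
    using choice unfolding I2_choice_def Let_def defs by (simp add: w)
  have c1: "card {{0, 1, 3 :: nat}} = 1"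
    by (simp add: set_eq_subset)
  note step1 = sparse_step[OF L0 _ R _ c1 _ reg1, of "{{1, 2, 3, 4}, {0, 2, 3, 4}}"]
  have L1: "labelled_polytope w 5 P1 ({{0, 1, 2, 4}, {0, 2, 3, 4}, {1, 2, 3, 4}, {0, 1, 3, 4}, {0, 1, 2}, {0, 2, 3}, {1, 2, 3}} \<union> R) {{1, 2, 3, 4}, {0, 2, 3, 4}}"
    using step1(1) unfolding P1_def by (simp add: beneath_def insert_commute)
  have f1: "fvec P1 = map2 (+) (fvec P0) [1, 4, 5, 2]"
    using step1(2) unfolding P1_def by (simp add: beneath_def insert_commute)
  have c2: "card {{1, 2, 4}, {1, 2, 3 :: nat}} = 2"
    by (simp add: set_eq_subset)
  \<comment> \<open>The simplex 2345 is kept because the third point is placed beyond it, too: it is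
    the facet across 234.\<close>
  note step2 = sparse_step[OF L1 _ R _ c2 _ reg2, of "{{0, 2, 3, 4}, {2, 3, 4, 5}}"]
  have L2: "labelled_polytope w 6 P2 ({{1, 3, 4, 5}, {2, 3, 4, 5}, {0, 1, 2, 4, 5}, {1, 2, 3, 5}, {0, 2, 3, 4}, {0, 1, 3, 4}, {0, 1, 2}, {0, 2, 3}} \<union> R) {{0, 2, 3, 4}, {2, 3, 4, 5}}"
    using step2(1) unfolding P2_def by (simp add: beneath_def insert_commute)
  have f2: "fvec P2 = map2 (+) (fvec P1) [1, 4, 4, 1]"
    using step2(2) unfolding P2_def by (simp add: beneath_def insert_commute)
  note step3 = I2_third_step[OF L2 R reg3, folded P3_def]
  note L3 = step3(1) and f3 = step3(2)
  have c4: "card {{3, 4, 6}, {3, 4, 5}, {3, 5, 6 :: nat}} = 3"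
    by (simp add: set_eq_subset)
  note step4 = sparse_step[OF L3 _ R _ c4 _ reg4, of "{}"]
  have f4: "fvec P4 = map2 (+) (fvec P3) [1, 4, 3, 0]"
    using step4(2) unfolding P4_def by (simp add: beneath_def insert_commute)
  have "I2_result P v4 v5 v6 v7 = P4"
    unfolding I2_result_def P4_def defs w ..
  moreover have "fvec P4 = map2 (+) (fvec P0) [4, 16, 16, 4]"
    unfolding f4 f3 f2 f1 by (simp add: fvec_def)
  ultimately show ?thesis
    unfolding P0_def by simp
qed

theorem theorem3p7:
  fixes P :: "(real^4) set" and v0 v1 v2 v3 :: "real^4"
  assumes "polytope P" and "aff_dim P = 4"
    and "card {v0, v1, v2, v3} = 4" and "\<not> affine_dependent {v0, v1, v2, v3}"
    and "convex hull {v0, v1, v2, v3} facet_of P"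
    and "bounded_position P (convex hull {v0, v1, v2, v3})"
  shows "(\<forall>v4 v5 v6 v7 v8. I1_choice P v0 v1 v2 v3 v4 v5 v6 v7 v8 \<longrightarrow>
            fvec (I1_result P v4 v5 v6 v7 v8) = map2 (+) (fvec P) [5, 20, 20, 5])
       \<and> (\<forall>v4 v5 v6 v7. I2_choice P v0 v1 v2 v3 v4 v5 v6 v7 \<longrightarrow>
            fvec (I2_result P v4 v5 v6 v7) = map2 (+) (fvec P) [4, 16, 16, 4])"
  using fvec_I1_result[OF assms(1-5)] fvec_I2_result[OF assms(1-5)] by blast

end
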